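(* Let $k$ be a positive integer. Every $(12k-1)$-edge connected, essentially $(2k+1)$-unbalanced signed graph $(G,\sigma)$ has a modulo $(2k+1)$-orientation.
   Context: A signed graph is a pair $(G,\sigma)$ where $G$ is a graph and $\sigma:E(G)\to\{1,-1\}$; edges with $\sigma(e)=1$ are positive, those with $\sigma(e)=-1$ negative. An orientation $\tau$ of $(G,\sigma)$ orients each positive edge $e=xy$ from one end to the other (if from $x$ to $y$, then $e\in E^+_\tau(x)\cap E^-_\tau(y)$), and labels each negative edge $e=xy$ either as a sink edge, with $e\in E^+_\tau(x)\cap E^+_\tau(y)$, or as a source edge, with $e\in E^-_\tau(x)\cap E^-_\tau(y)$. Write $d^\pm_\tau(x)=|E^\pm_\tau(x)|$. A modulo $(2k+1)$-orientation is an orientation $\tau$ with $d^+_\tau(x)-d^-_\tau(x)\equiv 0\pmod{2k+1}$ for every vertex $x$. Switching at a vertex $v$ negates the sign of every edge incident to $v$. Two signed graphs on the same underlying graph are equivalent if one is obtained from the other by a sequence of switchings. $(G,\sigma)$ is essentially $(2k+1)$-unbalanced if every signed graph equivalent to it has either an even number of negative edges or at least $2k+1$ negative edges. Edge connectivity refers to $G$. *)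

theory Defs
  imports Main
begin

definition multigraph :: "'v set \<Rightarrow> 'e set \<Rightarrow> ('e \<Rightarrow> 'v \<times> 'v) \<Rightarrow> bool" where
  "multigraph V E ep \<longleftrightarrow> finite V \<and> finite E \<and>
     (\<forall>e\<in>E. fst (ep e) \<in> V \<and> snd (ep e) \<in> V \<and> fst (ep e) \<noteq> snd (ep e))"

definition incident :: "('e \<Rightarrow> 'v \<times> 'v) \<Rightarrow> 'v \<Rightarrow> 'e \<Rightarrow> bool" where
  "incident ep x e \<longleftrightarrow> x = fst (ep e) \<or> x = snd (ep e)"

definition signature :: "'e set \<Rightarrow> ('e \<Rightarrow> int) \<Rightarrow> bool" where
  "signature E \<sigma> \<longleftrightarrow> (\<forall>e\<in>E. \<sigma> e = 1 \<or> \<sigma> e = -1)"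

text \<open>An orientation is encoded by tau e x = True iff e is in E+(x), for x an end of e.
  Positive edges: exactly one end has e in E+ (oriented from that end);
  negative edges: both ends in E+ (sink edge) or both in E- (source edge).\<close>
definition orientation :: "'e set \<Rightarrow> ('e \<Rightarrow> 'v \<times> 'v) \<Rightarrow> ('e \<Rightarrow> int) \<Rightarrow> ('e \<Rightarrow> 'v \<Rightarrow> bool) \<Rightarrow> bool" where
  "orientation E ep \<sigma> \<tau> \<longleftrightarrow>
     (\<forall>e\<in>E. (\<sigma> e = 1 \<longrightarrow> \<tau> e (fst (ep e)) \<noteq> \<tau> e (snd (ep e))) \<and>
            (\<sigma> e = -1 \<longrightarrow> \<tau> e (fst (ep e)) = \<tau> e (snd (ep e))))"

definition out_deg :: "'e set \<Rightarrow> ('e \<Rightarrow> 'v \<times> 'v) \<Rightarrow> ('e \<Rightarrow> 'v \<Rightarrow> bool) \<Rightarrow> 'v \<Rightarrow> nat" where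
  "out_deg E ep \<tau> x = card {e\<in>E. incident ep x e \<and> \<tau> e x}"

definition in_deg :: "'e set \<Rightarrow> ('e \<Rightarrow> 'v \<times> 'v) \<Rightarrow> ('e \<Rightarrow> 'v \<Rightarrow> bool) \<Rightarrow> 'v \<Rightarrow> nat" where
  "in_deg E ep \<tau> x = card {e\<in>E. incident ep x e \<and> \<not> \<tau> e x}"

definition mod_orientation :: "nat \<Rightarrow> 'v set \<Rightarrow> 'e set \<Rightarrow> ('e \<Rightarrow> 'v \<times> 'v) \<Rightarrow> ('e \<Rightarrow> int) \<Rightarrow> ('e \<Rightarrow> 'v \<Rightarrow> bool) \<Rightarrow> bool" where
  "mod_orientation m V E ep \<sigma> \<tau> \<longleftrightarrow> orientation E ep \<sigma> \<tau> \<and>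
     (\<forall>x\<in>V. (int (out_deg E ep \<tau> x) - int (in_deg E ep \<tau> x)) mod int m = 0)"

definition switch :: "('e \<Rightarrow> 'v \<times> 'v) \<Rightarrow> 'v \<Rightarrow> ('e \<Rightarrow> int) \<Rightarrow> ('e \<Rightarrow> int)" where
  "switch ep v \<sigma> = (\<lambda>e. if incident ep v e then - \<sigma> e else \<sigma> e)"

definition equivalent :: "'v set \<Rightarrow> ('e \<Rightarrow> 'v \<times> 'v) \<Rightarrow> ('e \<Rightarrow> int) \<Rightarrow> ('e \<Rightarrow> int) \<Rightarrow> bool" where
  "equivalent V ep \<sigma> \<sigma>' \<longleftrightarrow> (\<lambda>s t. \<exists>v\<in>V. t = switch ep v s)\<^sup>*\<^sup>* \<sigma> \<sigma>'"

definition neg_edges :: "'e set \<Rightarrow> ('e \<Rightarrow> int) \<Rightarrow> 'e set" where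
  "neg_edges E \<sigma> = {e\<in>E. \<sigma> e = -1}"

definition essentially_unbalanced :: "nat \<Rightarrow> 'v set \<Rightarrow> 'e set \<Rightarrow> ('e \<Rightarrow> 'v \<times> 'v) \<Rightarrow> ('e \<Rightarrow> int) \<Rightarrow> bool" where
  "essentially_unbalanced m V E ep \<sigma> \<longleftrightarrow>
     (\<forall>\<sigma>'. equivalent V ep \<sigma> \<sigma>' \<longrightarrow>
        even (card (neg_edges E \<sigma>')) \<or> card (neg_edges E \<sigma>') \<ge> m)"

definition edge_cut :: "'e set \<Rightarrow> ('e \<Rightarrow> 'v \<times> 'v) \<Rightarrow> 'v set \<Rightarrow> 'e set" where
  "edge_cut E ep X = {e\<in>E. (fst (ep e) \<in> X) \<noteq> (snd (ep e) \<in> X)}"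

definition edge_connected :: "nat \<Rightarrow> 'v set \<Rightarrow> 'e set \<Rightarrow> ('e \<Rightarrow> 'v \<times> 'v) \<Rightarrow> bool" where
  "edge_connected t V E ep \<longleftrightarrow>
     (\<forall>X. X \<subseteq> V \<and> X \<noteq> {} \<and> X \<noteq> V \<longrightarrow> card (edge_cut E ep X) \<ge> t)"

end

theory Submission
  imports Defs "HOL-Library.Multiset"
begin

text \<open>
  Switch to an equivalent signature with the fewest negative edges. Then at most half of every cut
  is negative, so the positive edges alone form a \<open>6k\<close>-edge connected graph. Essential unbalancedness
  makes it possible to choose sink and source edges such that the number of sinks minus the number of
  sources is divisible by \<open>2k+1\<close>; it remains to orient the positive edges with a prescribed boundary
  modulo \<open>2k+1\<close>.

  That this is possible is the theorem of Lovasz, Thomassen, Wu and Zhang, proved here by induction.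
  Its generalisation has a vertex \<open>z\<close> whose edges are already oriented, and asks for
  \<open>d(X) \<ge> 2K - 2 + nrm(b(X))\<close> for vertex sets \<open>X\<close> avoiding \<open>z\<close>, where \<open>K = 2k+1\<close> and demands \<open>b\<close> are
  normalised modulo \<open>2K\<close> by parity. Tight larger sets are contracted, and in the absence of tight
  sets one edge may be oriented or one pair of edges lifted. A vertex of demand \<open>0\<close> is eliminated by
  lifting all its edges in pairs, which is why one vertex \<open>u\<close> may be exempt from the degree condition.
  An edge from a vertex of positive to one of negative demand can be oriented and deleted. If all
  demands are positive, then exactly \<open>2K - 1\<close> edges leave \<open>z\<close>, and the demand of one vertex can be raised
  to \<open>K \<equiv> - K\<close>, which makes it count as negative.
\<close>

section \<open>Cuts and net out-degrees of multisets of edges\<close>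

text \<open>The net out-degree of a vertex has the parity of its degree. For odd \<open>K\<close> a
  residue modulo \<open>K\<close> together with this parity is one residue modulo
  \<open>2 * K\<close>, which is why demands live there and why degree and \<open>nrm\<close> of the
  demand always agree in parity. The bound \<open>2 * K - 2 + nrm\<close> occurs twice: as a lower
  bound for sets and as an upper bound for the degree of the preoriented vertex. If a tight set is
  contracted and the rest is solved, the edges leaving the set already have directions, and there
  are just few enough of them to be the edges of the preoriented vertex of the instance inside. This
  is what a preoriented vertex is for. In the absence of tight sets, parity gives every larger set a
  slack of 2, enough for one reduction. Single vertices have no such slack, so every reduction has
  to spare them exactly. Orienting an edge costs a vertex one degree and is harmless only if
  \<open>nrm\<close> of its demand drops too. This is impossible at demand 0, and the sign of the
  demand dictates the direction otherwise; demand \<open>K\<close> permits both.\<close>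

definition crosses :: "'v set \<Rightarrow> 'v \<times> 'v \<Rightarrow> int" where
  "crosses X e = of_bool ((fst e \<in> X) \<noteq> (snd e \<in> X))"

definition cut :: "('v \<times> 'v) multiset \<Rightarrow> 'v set \<Rightarrow> int" where
  "cut E X = (\<Sum>e\<in>#E. crosses X e)"

definition mult :: "('v \<times> 'v) multiset \<Rightarrow> 'v \<Rightarrow> 'v \<Rightarrow> int" where
  "mult E x y = (\<Sum>e\<in>#E. of_bool (e = (x, y) \<or> e = (y, x)))"

definition dir :: "'v \<times> 'v \<Rightarrow> 'v \<Rightarrow> int" where
  "dir e x = of_bool (fst e = x) - of_bool (snd e = x)"

definition net :: "('v \<times> 'v) multiset \<Rightarrow> 'v \<Rightarrow> int" where
  "net E x = (\<Sum>e\<in>#E. dir e x)"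

text \<open>Here \<open>N\<close> consists of the edges that are reversed.\<close>

definition achievable :: "('v \<times> 'v) multiset \<Rightarrow> ('v \<Rightarrow> int) \<Rightarrow> bool" where
  "achievable E f \<longleftrightarrow> (\<exists>P N. E = P + N \<and> f = (\<lambda>x. net P x - net N x))"

definition edges_on :: "'v set \<Rightarrow> ('v \<times> 'v) multiset \<Rightarrow> bool" where
  "edges_on U E \<longleftrightarrow> (\<forall>e\<in>#E. fst e \<in> U \<and> snd e \<in> U \<and> fst e \<noteq> snd e)"

lemma cut_empty [simp]: "cut {#} X = 0" by (simp add: cut_def)
lemma cut_add [simp]: "cut (add_mset e E) X = crosses X e + cut E X" by (simp add: cut_def)
lemma cut_union: "cut (E + F) X = cut E X + cut F X" by (simp add: cut_def)
lemma cut_nonneg: "0 \<le> cut E X" by (induction E) (auto simp: crosses_def)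
lemma net_empty [simp]: "net {#} x = 0" by (simp add: net_def)
lemma net_add [simp]: "net (add_mset e E) x = dir e x + net E x" by (simp add: net_def)
lemma net_union: "net (E + F) x = net E x + net F x" by (simp add: net_def)
lemma mult_empty [simp]: "mult {#} x y = 0" by (simp add: mult_def)
lemma mult_add [simp]: "mult (add_mset e E) x y = of_bool (e = (x, y) \<or> e = (y, x)) + mult E x y"
  by (simp add: mult_def)
lemma mult_nonneg: "0 \<le> mult E x y" by (induction E) auto
lemma edges_on_empty [simp]: "edges_on U {#}" by (simp add: edges_on_def)
lemma edges_on_add [simp]: "edges_on U (add_mset e E) \<longleftrightarrow> fst e \<in> U \<and> snd e \<in> U \<and> fst e \<noteq> snd e \<and> edges_on U E"
  by (auto simp: edges_on_def)
lemma edges_on_union: "edges_on U (E + F) \<longleftrightarrow> edges_on U E \<and> edges_on U F" by (auto simp: edges_on_def)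

lemma achievable_empty: "achievable {#} (\<lambda>x. 0)" by (auto simp: achievable_def)

lemma achievable_add:
  assumes "achievable E f"
  shows "achievable (add_mset e E) (\<lambda>x. f x + dir e x)" "achievable (add_mset e E) (\<lambda>x. f x - dir e x)"
proof -
  obtain P N where E: "E = P + N" and f: "f = (\<lambda>x. net P x - net N x)"
    using assms by (auto simp: achievable_def)
  show "achievable (add_mset e E) (\<lambda>x. f x + dir e x)"
    unfolding achievable_def E f by (rule exI[of _ "add_mset e P"], rule exI[of _ N]) auto
  show "achievable (add_mset e E) (\<lambda>x. f x - dir e x)"
    unfolding achievable_def E f by (rule exI[of _ P], rule exI[of _ "add_mset e N"]) auto
qed

lemma achievable_addE:
  assumes "achievable (add_mset e E) f"
  obtains g where "achievable E g" "f = (\<lambda>x. g x + dir e x) \<or> f = (\<lambda>x. g x - dir e x)"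
proof -
  obtain P N where E: "add_mset e E = P + N" and f: "f = (\<lambda>x. net P x - net N x)"
    using assms by (auto simp: achievable_def)
  have "e \<in># P + N" using E by (metis union_single_eq_member)
  then consider "e \<in># P" | "e \<in># N" by auto
  then show thesis
  proof cases
    case 1
    then obtain P' where P: "P = add_mset e P'" by (metis multi_member_split)
    then have "E = P' + N" using E by auto
    then have "achievable E (\<lambda>x. net P' x - net N x)" by (auto simp: achievable_def)
    then show thesis by (rule that) (auto simp: f P)
  next
    case 2
    then obtain N' where N: "N = add_mset e N'" by (metis multi_member_split)
    then have "E = P + N'" using E by auto
    then have "achievable E (\<lambda>x. net P x - net N' x)" by (auto simp: achievable_def)
    then show thesis by (rule that) (auto simp: f N)
  qed
qed

lemma achievable_union:
  assumes "achievable E f" "achievable F g"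
  shows "achievable (E + F) (\<lambda>x. f x + g x)"
proof -
  obtain P N where 1: "E = P + N" "f = (\<lambda>x. net P x - net N x)"
    using assms by (auto simp: achievable_def)
  obtain P' N' where 2: "F = P' + N'" "g = (\<lambda>x. net P' x - net N' x)"
    using assms by (auto simp: achievable_def)
  show ?thesis unfolding achievable_def 1 2
    by (rule exI[of _ "P + P'"], rule exI[of _ "N + N'"]) (auto simp: net_union)
qed

lemma achievable_uminus: "achievable E f \<Longrightarrow> achievable E (\<lambda>x. - f x)"
  unfolding achievable_def by (metis add.commute minus_diff_eq)

lemma achievable_bound:
  assumes "achievable E f" shows "\<bar>f x\<bar> \<le> cut E {x}"
  using assms
proof (induction E arbitrary: f)
  case empty
  then show ?case by (auto simp: achievable_def)
next
  case (add e E)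
  then obtain g where g: "achievable E g" "f = (\<lambda>x. g x + dir e x) \<or> f = (\<lambda>x. g x - dir e x)"
    by (blast elim: achievable_addE)
  have "\<bar>dir e x\<bar> \<le> crosses {x} e" by (auto simp: dir_def crosses_def)
  then show ?case using add.IH[OF g(1)] g(2) by auto
qed

lemma achievable_parity:
  assumes "achievable E f" shows "even (f x + cut E {x})"
  using assms
proof (induction E arbitrary: f)
  case empty
  then show ?case by (auto simp: achievable_def)
next
  case (add e E)
  then obtain g where g: "achievable E g" "f = (\<lambda>x. g x + dir e x) \<or> f = (\<lambda>x. g x - dir e x)"
    by (blast elim: achievable_addE)
  have "even (dir e x + crosses {x} e)" by (auto simp: dir_def crosses_def)
  then show ?case using add.IH[OF g(1)] g(2) by auto
qed

lemma net_image:
  assumes "finite U" "edges_on U E"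
  shows "net (image_mset (map_prod \<phi> \<phi>) E) z = (\<Sum>x\<in>{x\<in>U. \<phi> x = z}. net E x)"
  using assms(2)
proof (induction E)
  case empty
  then show ?case by simp
next
  case (add e E)
  have *: "(\<Sum>x\<in>{x\<in>U. \<phi> x = z}. of_bool (a = x)) = (of_bool (\<phi> a = z) :: int)" if "a \<in> U" for a
    using that assms(1) by (simp add: of_bool_def sum.delta)
  show ?case using add * by (auto simp: sum.distrib sum_subtractf dir_def)
qed

text \<open>Contraction keeps every edge, so an orientation of the contracted multigraph is one of
  the original. Nets add up over the fibres of \<open>\<phi>\<close>, because edges inside a fibre
  become loops and contribute 0.\<close>

lemma achievable_image:
  assumes "finite U" "edges_on U E" "achievable (image_mset (map_prod \<phi> \<phi>) E) f"
  shows "\<exists>g. achievable E g \<and> f = (\<lambda>z. \<Sum>x\<in>{x\<in>U. \<phi> x = z}. g x)"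
proof -
  obtain P N where E: "image_mset (map_prod \<phi> \<phi>) E = P + N" and f: "f = (\<lambda>x. net P x - net N x)"
    using assms by (auto simp: achievable_def)
  obtain P' N' where E': "E = P' + N'" "P = image_mset (map_prod \<phi> \<phi>) P'" "N = image_mset (map_prod \<phi> \<phi>) N'"
    using image_mset_eq_plusD[OF E] by blast
  have edges_on: "edges_on U P'" "edges_on U N'" using assms(2) E' by (auto simp: edges_on_def)
  have "f = (\<lambda>z. \<Sum>x\<in>{x\<in>U. \<phi> x = z}. net P' x - net N' x)"
    unfolding f E' net_image[OF assms(1) edges_on(1)] net_image[OF assms(1) edges_on(2)] by (simp add: sum_subtractf)
  moreover have "achievable E (\<lambda>x. net P' x - net N' x)" using E' by (auto simp: achievable_def)
  ultimately show ?thesis by blast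
qed

lemma cut_image: "cut (image_mset (map_prod \<phi> \<phi>) E) Y = cut E (\<phi> -` Y)"
  by (induction E) (auto simp: crosses_def)

lemma cut_cong: "edges_on U E \<Longrightarrow> X \<inter> U = Y \<inter> U \<Longrightarrow> cut E X = cut E Y"
  by (induction E) (auto simp: crosses_def)

lemma cut_compl: "edges_on U E \<Longrightarrow> cut E (U - X) = cut E X"
  by (induction E) (auto simp: crosses_def)

lemma cut_insert:
  "x \<noteq> y \<Longrightarrow> cut E {x, y} = cut E {x} + cut E {y} - 2 * mult E x y"
  by (induction E) (auto simp: crosses_def)

lemma cut_singleton_sum:
  assumes "finite W" "edges_on (insert u W) E" "u \<notin> W"
  shows "cut E {u} = (\<Sum>y\<in>W. mult E u y)"
  using assms(2)
proof (induction E)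
  case empty
  then show ?case by simp
next
  case (add e E)
  have "crosses {u} e = (\<Sum>y\<in>W. of_bool (e = (u, y) \<or> e = (y, u)))"
  proof (cases "fst e = u \<or> snd e = u")
    case True
    have "(\<Sum>y\<in>W. of_bool (e = (u, y) \<or> e = (y, u))) =
      (\<Sum>y\<in>W. of_bool (y = (if fst e = u then snd e else fst e)) :: int)"
      using True assms(3) by (intro sum.cong) (auto simp: prod_eq_iff)
    also have "\<dots> = of_bool ((if fst e = u then snd e else fst e) \<in> W)"
      using assms(1) by (simp add: of_bool_def sum.delta)
    also have "\<dots> = crosses {u} e" using True add.prems assms(3) by (auto simp: crosses_def)
    finally show ?thesis by simp
  next
    case False
    then have "e \<noteq> (u, y)" "e \<noteq> (y, u)" for y by auto
    then show ?thesis using False by (simp add: crosses_def)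
  qed
  then show ?case using add by (simp add: sum.distrib)
qed

text \<open>Handshake argument: an edge inside \<open>X\<close> is counted twice by the sum and an
  edge leaving \<open>X\<close> once.\<close>

lemma cut_parity:
  assumes "finite X"
  shows "even (cut E X + (\<Sum>x\<in>X. cut E {x}))"
proof (induction E)
  case empty
  then show ?case by simp
next
  case (add e E)
  have *: "(\<Sum>x\<in>X. of_bool (fst e = x)) = (of_bool (fst e \<in> X) :: int)"
          "(\<Sum>x\<in>X. of_bool (snd e = x)) = (of_bool (snd e \<in> X) :: int)"
    using assms by (simp_all add: of_bool_def sum.delta)
  have "(\<Sum>x\<in>X. crosses {x} e) = (\<Sum>x\<in>X. of_bool (fst e = x) + of_bool (snd e = x) -
      2 * of_bool (fst e = x \<and> snd e = x))"
    by (intro sum.cong) (auto simp: crosses_def)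
  also have "\<dots> = of_bool (fst e \<in> X) + of_bool (snd e \<in> X) -
      2 * (\<Sum>x\<in>X. of_bool (fst e = x \<and> snd e = x))"
    by (simp add: sum.distrib sum_subtractf * sum_distrib_left)
  finally have "even (crosses X e + (\<Sum>x\<in>X. crosses {x} e))" by (auto simp: crosses_def)
  then show ?case using add by (simp add: sum.distrib)
qed

lemma cut_sum_independent:
  assumes "finite X" "\<forall>e\<in>#E. \<not> (fst e \<in> X \<and> snd e \<in> X)" "Y \<subseteq> X"
  shows "cut E Y = (\<Sum>x\<in>Y. cut E {x})"
  using assms(2)
proof (induction E)
  case empty
  then show ?case by simp
next
  case (add e E)
  have fin: "finite Y" using assms by (auto intro: finite_subset)
  have *: "(\<Sum>x\<in>Y. of_bool (fst e = x)) = (of_bool (fst e \<in> Y) :: int)"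
          "(\<Sum>x\<in>Y. of_bool (snd e = x)) = (of_bool (snd e \<in> Y) :: int)"
    using fin by (simp_all add: of_bool_def sum.delta)
  have "(\<Sum>x\<in>Y. crosses {x} e) = (\<Sum>x\<in>Y. of_bool (fst e = x) + of_bool (snd e = x))"
    using add.prems assms(3) by (intro sum.cong) (auto simp: crosses_def)
  also have "\<dots> = crosses Y e"
    using add.prems assms(3) by (auto simp: sum.distrib * crosses_def)
  finally show ?case using add by (simp add: sum.distrib)
qed

lemma edge_between:
  assumes "cut E (A \<union> B) < cut E A + cut E B" "A \<inter> B = {}"
  shows "\<exists>x\<in>A. \<exists>y\<in>B. mult E x y > 0"
  using assms
proof (induction E)
  case empty
  then show ?case by simp
next
  case (add e E)
  show ?case
  proof (cases "cut E (A \<union> B) < cut E A + cut E B")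
    case True
    then obtain x y where "x \<in> A" "y \<in> B" "mult E x y > 0" using add by blast
    then show ?thesis by (intro bexI[of _ x] bexI[of _ y]) auto
  next
    case False
    then have "crosses (A \<union> B) e < crosses A e + crosses B e" using add by simp
    then have "(fst e \<in> A \<and> snd e \<in> B) \<or> (fst e \<in> B \<and> snd e \<in> A)"
      using add.prems by (auto simp: crosses_def split: if_splits)
    then show ?thesis
    proof
      assume "fst e \<in> A \<and> snd e \<in> B"
      then show ?thesis using mult_nonneg[of E "fst e" "snd e"]
        by (intro bexI[of _ "fst e"] bexI[of _ "snd e"]) auto
    next
      assume "fst e \<in> B \<and> snd e \<in> A"
      then show ?thesis using mult_nonneg[of E "snd e" "fst e"]
        by (intro bexI[of _ "fst e"] bexI[of _ "snd e"]) auto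
    qed
  qed
qed

text \<open>An edge between \<open>x\<close> and \<open>y\<close> may be stored in either order. The
  conclusions speak of \<open>(x, y)\<close> only, so that the stored order never matters when an
  edge is removed and put back in a chosen direction.\<close>

lemma take_edge:
  assumes "mult E x y > 0"
  obtains R where "\<And>X. cut E X = crosses X (x, y) + cut R X" "size E = Suc (size R)" "set_mset R \<subseteq> set_mset E"
    "\<And>f. achievable R f \<Longrightarrow> achievable E (\<lambda>z. f z + dir (x, y) z)"
    "\<And>f. achievable R f \<Longrightarrow> achievable E (\<lambda>z. f z - dir (x, y) z)"
    "\<And>a b. mult E a b = of_bool ((x, y) = (a, b) \<or> (x, y) = (b, a)) + mult R a b"
proof -
  have "\<exists>e\<in>#E. e = (x, y) \<or> e = (y, x)"
  proof (rule ccontr)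
    assume *: "\<not> ?thesis"
    then have "\<forall>e\<in>#E. of_bool (e = (x, y) \<or> e = (y, x)) = (0 :: int)" by auto
    then have "mult E x y = 0" unfolding mult_def by (intro sum_mset.neutral) auto
    then show False using assms by simp
  qed
  then obtain e where e: "e \<in># E" "e = (x, y) \<or> e = (y, x)" by blast
  then obtain R where R: "E = add_mset e R" by (metis multi_member_split)
  show thesis
  proof (rule that[of R])
    show "\<And>X. cut E X = crosses X (x, y) + cut R X" using e R by (auto simp: crosses_def)
    show "size E = Suc (size R)" using R by simp
    show "set_mset R \<subseteq> set_mset E" using R by auto
    fix f assume f: "achievable R f"
    have swap: "(\<lambda>z. f z + dir (y, x) z) = (\<lambda>z. f z - dir (x, y) z)"
      "(\<lambda>z. f z - dir (y, x) z) = (\<lambda>z. f z + dir (x, y) z)"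
      by (simp_all add: dir_def fun_eq_iff)
    have "achievable E (\<lambda>z. f z + dir e z) \<and> achievable E (\<lambda>z. f z - dir e z)"
      unfolding R using achievable_add[OF f] by blast
    then have "achievable E (\<lambda>z. f z + dir (x, y) z) \<and> achievable E (\<lambda>z. f z - dir (x, y) z)"
      using e(2) by (elim disjE) (simp_all only: swap)
    then show "achievable E (\<lambda>z. f z + dir (x, y) z)" "achievable E (\<lambda>z. f z - dir (x, y) z)" by simp_all
  next
    fix a b
    have "(e = (a, b) \<or> e = (b, a)) = ((x, y) = (a, b) \<or> (x, y) = (b, a))" using e(2) by auto
    then show "mult E a b = of_bool ((x, y) = (a, b) \<or> (x, y) = (b, a)) + mult R a b"
      unfolding R mult_add by simp
  qed
qed

text \<open>The number \<open>j\<close> counts the parallel edges directed into \<open>x\<close>;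
  all others leave \<open>x\<close>.\<close>

lemma achievable_parallel:
  assumes "\<forall>e\<in>#E. fst e = snd e \<or> e = (x, y) \<or> e = (y, x)" "x \<noteq> y" "0 \<le> j" "j \<le> cut E {x}"
  shows "\<exists>h. achievable E h \<and> h x = cut E {x} - 2 * j \<and> h y = - (cut E {x} - 2 * j)"
  using assms(1,3,4)
proof (induction E arbitrary: j)
  case empty
  then show ?case using achievable_empty by (intro exI[of _ "\<lambda>x. 0"]) auto
next
  case (add e E)
  show ?case
  proof (cases "fst e = snd e")
    case True
    then have "crosses {x} e = 0" "\<And>z. dir e z = 0" by (auto simp: crosses_def dir_def)
    then show ?thesis using add.IH[of j] add.prems achievable_add[of E _ e] by fastforce
  next
    case False
    then have e: "e = (x, y) \<or> e = (y, x)" using add.prems by auto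
    have c: "crosses {x} e = 1" using e assms(2) by (auto simp: crosses_def)
    have d: "dir e x = 1 \<and> dir e y = -1 \<or> dir e x = -1 \<and> dir e y = 1"
      using e assms(2) by (auto simp: dir_def)
    \<comment> \<open>If \<open>j = 0\<close>, the new edge has to leave \<open>x\<close>; otherwise
      it is made one of the \<open>j\<close> edges entering \<open>x\<close>.\<close>
    define i where "i = (if j = 0 then 0 else j - 1)"
    define a where "a = (if j = 0 then 1 else - 1 :: int)"
    have "0 \<le> i" "i \<le> cut E {x}"
      using add.prems c cut_nonneg[of E "{x}"] by (auto simp: i_def)
    then obtain h where h: "achievable E h" "h x = cut E {x} - 2 * i" "h y = - (cut E {x} - 2 * i)"
      using add.IH[of i] add.prems by auto
    define h' where "h' = (if dir e x = a then (\<lambda>z. h z + dir e z) else (\<lambda>z. h z - dir e z))"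
    have "achievable (add_mset e E) h'" unfolding h'_def using achievable_add[OF h(1), of e] by simp
    moreover have "h' x = cut (add_mset e E) {x} - 2 * j" "h' y = - (cut (add_mset e E) {x} - 2 * j)"
      using d c h by (auto simp: h'_def a_def i_def)
    ultimately show ?thesis by blast
  qed
qed

section \<open>Distance to the nearest multiple of 2K\<close>

definition nrm :: "int \<Rightarrow> int \<Rightarrow> int" where
  "nrm K n = min (n mod (2 * K)) (2 * K - n mod (2 * K))"

text \<open>Here \<open>r\<close> is the signed representative of least absolute value. The
  half-open range gives the class of \<open>K\<close>, the only one of ambiguous sign, the
  representative \<open>K\<close> and not \<open>- K\<close>.\<close>

lemma nrm_decomp:
  assumes "K > 0"
  obtains q r where "n = 2 * K * q + r" "\<bar>r\<bar> \<le> K" "nrm K n = \<bar>r\<bar>" "- K < r"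
proof (cases "n mod (2 * K) \<le> K")
  case True
  have "n mod (2 * K) \<ge> 0" using assms by simp
  then have "- K < n mod (2 * K)" "\<bar>n mod (2 * K)\<bar> \<le> K" "nrm K n = \<bar>n mod (2 * K)\<bar>"
    using True assms unfolding nrm_def by linarith+
  then show thesis by (intro that[of "n div (2 * K)" "n mod (2 * K)"]) simp_all
next
  case False
  have "n mod (2 * K) < 2 * K" using assms by simp
  then have *: "- K < n mod (2 * K) - 2 * K" "\<bar>n mod (2 * K) - 2 * K\<bar> \<le> K"
    "nrm K n = \<bar>n mod (2 * K) - 2 * K\<bar>"
    using False unfolding nrm_def by linarith+
  have "n = 2 * K * (n div (2 * K)) + n mod (2 * K)" by simp
  then have "n = 2 * K * (n div (2 * K) + 1) + (n mod (2 * K) - 2 * K)"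
    unfolding distrib_left by linarith
  from that[OF this *(2,3,1)] show thesis .
qed

lemma nrm_le_abs:
  assumes "K > 0" shows "nrm K (2 * K * q + r) \<le> \<bar>r\<bar>"
proof -
  have "(2 * K * q + r) mod (2 * K) = r mod (2 * K)" by simp
  moreover have "min (r mod (2 * K)) (2 * K - r mod (2 * K)) \<le> \<bar>r\<bar>"
  proof (cases "r \<ge> 0")
    case True
    then show ?thesis using zmod_le_nonneg_dividend[of r "2 * K"] by auto
  next
    case False
    have "(- r) mod (2 * K) \<le> - r" using False zmod_le_nonneg_dividend[of "- r" "2 * K"] by auto
    moreover have "2 * K - r mod (2 * K) = (- r) mod (2 * K) \<or> r mod (2 * K) = 0"
      using zmod_zminus1_eq_if[of r "2 * K"] by auto
    ultimately show ?thesis by auto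
  qed
  ultimately show ?thesis unfolding nrm_def by simp
qed

lemma nrm_cong: "2 * K dvd a - b \<Longrightarrow> nrm K a = nrm K b"
  unfolding nrm_def by (metis mod_eq_dvd_iff)

lemma nrm_nonneg: "K > 0 \<Longrightarrow> 0 \<le> nrm K n"
  by (metis nrm_decomp abs_ge_zero)

lemma nrm_le: "K > 0 \<Longrightarrow> nrm K n \<le> K"
  by (metis nrm_decomp)

lemma nrm_uminus:
  assumes "K > 0" shows "nrm K (- n) = nrm K n"
proof -
  have "nrm K (- n) \<le> nrm K n" for n
  proof -
    obtain q r where *: "n = 2 * K * q + r" "\<bar>r\<bar> \<le> K" "nrm K n = \<bar>r\<bar>" using assms by (rule nrm_decomp)
    have "nrm K (2 * K * (- q) + (- r)) \<le> \<bar>- r\<bar>" using assms by (rule nrm_le_abs)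
    then show ?thesis using * by simp
  qed
  from this[of n] this[of "- n"] show ?thesis by simp
qed

lemma nrm_triangle:
  assumes "K > 0" shows "nrm K (a + b) \<le> nrm K a + nrm K b"
proof -
  obtain q r where *: "a = 2 * K * q + r" "\<bar>r\<bar> \<le> K" "nrm K a = \<bar>r\<bar>" using assms by (rule nrm_decomp)
  obtain q' r' where **: "b = 2 * K * q' + r'" "\<bar>r'\<bar> \<le> K" "nrm K b = \<bar>r'\<bar>" using assms by (rule nrm_decomp)
  have "nrm K (2 * K * (q + q') + (r + r')) \<le> \<bar>r + r'\<bar>" using assms by (rule nrm_le_abs)
  then show ?thesis using * ** by (simp add: algebra_simps)
qed

lemma nrm_le_self: "K > 0 \<Longrightarrow> nrm K a \<le> \<bar>a\<bar>"
  using nrm_le_abs[of K 0 a] by simp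

lemma nrm_shift:
  assumes "K > 0" "\<bar>a - b\<bar> \<le> 1" shows "nrm K a \<le> nrm K b + 1"
  using nrm_triangle[OF assms(1), of b "a - b"] nrm_le_self[OF assms(1), of "a - b"] assms by simp

lemma nrm_parity:
  assumes "K > 0" shows "even (nrm K n + n)"
proof -
  obtain q r where *: "n = 2 * K * q + r" "nrm K n = \<bar>r\<bar>" using assms by (rule nrm_decomp)
  then show ?thesis by (auto simp: abs_if)
qed

lemma nrm_eq:
  assumes "K > 0" "\<bar>r\<bar> \<le> K" shows "nrm K (2 * K * q + r) = \<bar>r\<bar>"
proof -
  have eq: "nrm K (2 * K * q + r) = nrm K \<bar>r\<bar>"
    using nrm_uminus[OF assms(1), of r] nrm_cong[of K "2 * K * q + r" r] by (auto simp: abs_if)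
  have "\<bar>r\<bar> mod (2 * K) = \<bar>r\<bar>" using assms by (intro mod_pos_pos_trivial) auto
  then show ?thesis unfolding eq using assms unfolding nrm_def by linarith
qed

text \<open>A nonzero class has a step towards 0, and the direction of that step is its sign.
  Stating signs through \<open>nrm\<close> rather than through a representative lets the class of
  \<open>K\<close> satisfy both of the last alternatives.\<close>

lemma nrm_trichotomy:
  assumes "K > 0"
  shows "2 * K dvd n \<or> nrm K (n - 1) = nrm K n - 1 \<or> nrm K (n + 1) = nrm K n - 1"
proof -
  obtain q r where *: "n = 2 * K * q + r" "\<bar>r\<bar> \<le> K" "nrm K n = \<bar>r\<bar>" using assms by (rule nrm_decomp)
  have 1: "n - 1 = 2 * K * q + (r - 1)" and 2: "n + 1 = 2 * K * q + (r + 1)" using *(1) by simp_all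
  have "nrm K (n - 1) = \<bar>r - 1\<bar> \<or> r \<le> 0" "nrm K (n + 1) = \<bar>r + 1\<bar> \<or> r \<ge> 0"
    unfolding 1 2 using nrm_eq[OF assms, of "r - 1" q] nrm_eq[OF assms, of "r + 1" q] *(2) by linarith+
  moreover have "r = 0 \<Longrightarrow> 2 * K dvd n" using *(1) by simp
  ultimately show ?thesis using *(3) by linarith
qed

lemma nrm_strict_pos:
  assumes "K > 0" "nrm K (n - 1) = nrm K n - 1" "nrm K (n + 1) \<noteq> nrm K n - 1"
  obtains q t where "n = 2 * K * q + t" "1 \<le> t" "t \<le> K - 1" "nrm K n = t"
proof -
  obtain q r where *: "n = 2 * K * q + r" "\<bar>r\<bar> \<le> K" "nrm K n = \<bar>r\<bar>" "- K < r"
    using assms(1) by (rule nrm_decomp)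
  have "r \<noteq> K"
  proof
    assume "r = K"
    then have eq: "n + 1 = 2 * K * (q + 1) + (1 - K)" using * by (simp add: algebra_simps)
    have "nrm K (n + 1) = \<bar>1 - K\<bar>" unfolding eq using nrm_eq[OF assms(1), of "1 - K" "q + 1"] assms(1) by linarith
    then show False using assms * \<open>r = K\<close> by simp
  qed
  moreover have "r > 0"
  proof (rule ccontr)
    assume "\<not> r > 0"
    then have "nrm K (n - 1) = \<bar>r - 1\<bar>"
      using nrm_eq[OF assms(1), of "r - 1" q] * by (simp add: algebra_simps)
    then show False using assms(2) * \<open>\<not> r > 0\<close> by simp
  qed
  ultimately show thesis using * by (intro that[of q r]) auto
qed

section \<open>Instances with a preoriented vertex\<close>

definition deg :: "('v \<times> 'v) multiset \<Rightarrow> ('v \<Rightarrow> int) \<Rightarrow> 'v set \<Rightarrow> int" where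
  "deg E w X = cut E X + sum w X"

text \<open>
  The preoriented vertex \<open>z\<close> is not a member of \<open>insert u W\<close>: \<open>w x\<close> is the number of edges between \<open>x\<close>
  and \<open>z\<close>, and \<open>s x\<close> is the number of those leaving \<open>x\<close> minus the number of those entering \<open>x\<close>.
  The demand \<open>b x\<close> counts all edges at \<open>x\<close>, so that \<open>E\<close> has to contribute \<open>b x - s x\<close> modulo \<open>2K\<close>.
  The last two conditions say that no neighbour of \<open>u\<close>, nor \<open>z\<close>, is joined to \<open>u\<close> by more than half of
  the edges at \<open>u\<close>, without which these edges could not be lifted in pairs.
\<close>

definition admissible :: "int \<Rightarrow> 'v set \<Rightarrow> 'v \<Rightarrow> ('v \<times> 'v) multiset \<Rightarrow> ('v \<Rightarrow> int) \<Rightarrow> ('v \<Rightarrow> int) \<Rightarrow> ('v \<Rightarrow> int) \<Rightarrow> bool" where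
  "admissible K W u E b s w \<longleftrightarrow>
     finite W \<and> u \<notin> W \<and> 2 \<le> card W \<and> edges_on (insert u W) E \<and>
     (\<forall>x\<in>insert u W. \<bar>s x\<bar> \<le> w x \<and> even (w x + s x) \<and> even (cut E {x} + w x + b x)) \<and>
     2 * K dvd (\<Sum>x\<in>insert u W. b x - s x) \<and> 2 * K dvd b u \<and>
     sum w (insert u W) \<le> 2 * K - 2 + nrm K (sum s (insert u W)) \<and>
     (\<forall>X. X \<subseteq> insert u W \<and> X \<inter> W \<noteq> {} \<and> \<not> W \<subseteq> X \<longrightarrow> 2 * K - 2 + nrm K (sum b X) \<le> deg E w X) \<and>
     (\<forall>y\<in>W. deg E w {y} \<le> deg E w {u, y}) \<and> w u \<le> cut E {u}"

definition solvable :: "int \<Rightarrow> 'v set \<Rightarrow> ('v \<times> 'v) multiset \<Rightarrow> ('v \<Rightarrow> int) \<Rightarrow> bool" where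
  "solvable K U E c \<longleftrightarrow> (\<exists>f. achievable E f \<and> (\<forall>x\<in>U. 2 * K dvd f x - c x))"

lemma admissibleD:
  assumes "admissible K W u E b s w"
  shows "finite W" "u \<notin> W" "2 \<le> card W" "edges_on (insert u W) E"
    "\<And>x. x \<in> insert u W \<Longrightarrow> \<bar>s x\<bar> \<le> w x"
    "\<And>x. x \<in> insert u W \<Longrightarrow> even (w x + s x)"
    "\<And>x. x \<in> insert u W \<Longrightarrow> even (cut E {x} + w x + b x)"
    "2 * K dvd (\<Sum>x\<in>insert u W. b x - s x)" "2 * K dvd b u"
    "sum w (insert u W) \<le> 2 * K - 2 + nrm K (sum s (insert u W))"
    "\<And>X. X \<subseteq> insert u W \<Longrightarrow> X \<inter> W \<noteq> {} \<Longrightarrow> \<not> W \<subseteq> X \<Longrightarrow> 2 * K - 2 + nrm K (sum b X) \<le> deg E w X"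
    "\<And>y. y \<in> W \<Longrightarrow> deg E w {y} \<le> deg E w {u, y}" "w u \<le> cut E {u}"
  using assms unfolding admissible_def by blast+

lemma deg_parity:
  assumes "finite X" "\<forall>x\<in>X. even (cut E {x} + w x + b x)"
  shows "even (deg E w X + sum b X)"
proof -
  have "even (\<Sum>x\<in>X. cut E {x} + w x + b x)" using assms(2) by (intro dvd_sum) auto
  then have "even ((\<Sum>x\<in>X. cut E {x}) + sum w X + sum b X)" by (simp add: sum.distrib)
  then show ?thesis using cut_parity[OF assms(1), of E] unfolding deg_def by presburger
qed

section \<open>Contraction of vertex sets\<close>

text \<open>A solution of the contracted instance is pulled back to the edges \<open>G\<close> not inside \<open>X\<close>; it then
  has to be extended to the edges \<open>F\<close> inside \<open>X\<close>, for which it acts as a preorientation.\<close>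

lemma contract:
  assumes K: "2 \<le> K" and admissible: "admissible K W u E b s w"
    and X: "X \<subseteq> insert u W" "2 \<le> card (X \<inter> W)" "\<not> W \<subseteq> X"
    and uX: "u \<in> X \<or> deg E w X \<le> deg E w (insert u X)"
    and IH: "\<And>W' b' s' w' E'. card W' < card W \<Longrightarrow> admissible K W' u E' b' s' w' \<Longrightarrow> solvable K (insert u W') E' (\<lambda>x. b' x - s' x)"
    and inside: "\<And>g F G. E = F + G \<Longrightarrow> achievable G g \<Longrightarrow> \<forall>e\<in>#F. fst e \<in> X \<and> snd e \<in> X \<Longrightarrow>
      \<forall>e\<in>#G. \<not> (fst e \<in> X \<and> snd e \<in> X) \<Longrightarrow> 2 * K dvd (\<Sum>x\<in>X. b x - s x - g x) \<Longrightarrow>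
      solvable K X F (\<lambda>x. b x - s x - g x)"
  shows "solvable K (insert u W) E (\<lambda>x. b x - s x)"
proof -
  let ?U = "insert u W"
  have fin: "finite W" "finite ?U" "u \<notin> W" using admissibleD(1,2)[OF admissible] by simp_all
  note edges_on = admissibleD(4)[OF admissible] and loc = admissibleD(5-7)[OF admissible] and sets = admissibleD(11)[OF admissible]
  obtain a where a: "a \<in> X" "a \<in> W" using X(2) by (cases "X \<inter> W = {}") auto
  \<comment> \<open>The representative is taken in \<open>W\<close>, so the contracted vertex is
    never the exempt one. If \<open>u \<in> X\<close>, then \<open>u\<close> survives with an empty
    fibre: \<open>push\<close> vanishes there and no edge is left at it.\<close>
  define \<phi> where "\<phi> = (\<lambda>z. if z \<in> X then a else z)"
  define W' where "W' = insert a (W - X)"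
  define push where "push = (\<lambda>(h :: 'a \<Rightarrow> int) z. \<Sum>x\<in>{x\<in>?U. \<phi> x = z}. h x)"
  define F where "F = filter_mset (\<lambda>e. fst e \<in> X \<and> snd e \<in> X) E"
  define G where "G = filter_mset (\<lambda>e. \<not> (fst e \<in> X \<and> snd e \<in> X)) E"
  define E' where "E' = image_mset (map_prod \<phi> \<phi>) G"
  let ?U' = "insert u W'"
  have EFG: "E = F + G" unfolding F_def G_def by (rule multiset_partition)
  have onFG: "edges_on ?U F" "edges_on ?U G" using edges_on unfolding EFG edges_on_union by auto
  have F: "\<forall>e\<in>#F. fst e \<in> X \<and> snd e \<in> X" and G: "\<forall>e\<in>#G. \<not> (fst e \<in> X \<and> snd e \<in> X)"
    by (auto simp: F_def G_def)
  have uW': "u \<notin> W'" using fin a by (auto simp: W'_def)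
  have finW': "finite W'" using fin by (auto simp: W'_def)
  have cardW': "card W' = card (W - X) + 1" using fin a by (simp add: W'_def)
  have cardX: "card (W - X) + card (X \<inter> W) = card W"
    using card_Int_Diff[OF fin(1), of X] by (simp add: Int_commute)
  have cardlt: "card W' < card W" using cardW' cardX X(2) by simp
  have "card (W - X) \<noteq> 0" using X(3) fin by auto
  then have card2: "2 \<le> card W'" using cardW' by simp
  have push_sum: "sum (push h) Y = sum h {x\<in>?U. \<phi> x \<in> Y}" if "finite Y" for h Y
  proof -
    have "sum h {x\<in>?U. \<phi> x \<in> Y} = (\<Sum>y\<in>Y. \<Sum>x\<in>{x\<in>{x\<in>?U. \<phi> x \<in> Y}. \<phi> x = y}. h x)"
      using fin that by (intro sum.group[symmetric]) auto
    also have "(\<Sum>y\<in>Y. \<Sum>x\<in>{x\<in>{x\<in>?U. \<phi> x \<in> Y}. \<phi> x = y}. h x) = sum (push h) Y"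
    proof (rule sum.cong[OF refl])
      fix y assume "y \<in> Y"
      then have "{x\<in>{x\<in>?U. \<phi> x \<in> Y}. \<phi> x = y} = {x\<in>?U. \<phi> x = y}" by auto
      then show "(\<Sum>x\<in>{x\<in>{x\<in>?U. \<phi> x \<in> Y}. \<phi> x = y}. h x) = push h y" by (simp only: push_def)
    qed
    finally show ?thesis by simp
  qed
  have cutE': "cut E' Y = cut E {x\<in>?U. \<phi> x \<in> Y}" for Y
  proof -
    have "cut E' Y = cut G (\<phi> -` Y)" unfolding E'_def by (rule cut_image)
    also have "\<dots> = cut E (\<phi> -` Y)"
    proof -
      have "cut F (\<phi> -` Y) = 0" unfolding cut_def
        by (rule sum_mset.neutral) (use F in \<open>auto simp: crosses_def \<phi>_def\<close>)
      then show ?thesis unfolding EFG by (simp add: cut_union)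
    qed
    also have "\<dots> = cut E {x\<in>?U. \<phi> x \<in> Y}" by (rule cut_cong[OF edges_on]) auto
    finally show ?thesis .
  qed
  have degE': "deg E' (push w) Y = deg E w {x\<in>?U. \<phi> x \<in> Y}" if "finite Y" for Y
    unfolding deg_def cutE' push_sum[OF that] ..
  have \<phi>U: "\<phi> x \<in> ?U'" if "x \<in> ?U" for x using that by (auto simp: \<phi>_def W'_def)
  have allU: "{x\<in>?U. \<phi> x \<in> ?U'} = ?U" using \<phi>U by auto
  have push_one: "push h z = sum h {x\<in>?U. \<phi> x \<in> {z}}" for h z unfolding push_def by simp
  have preu: "{x\<in>?U. \<phi> x \<in> {u}} = (if u \<in> X then {} else {u})"
    using a fin by (auto simp: \<phi>_def)
  have prea: "{x\<in>?U. \<phi> x \<in> {a}} = X" using a X by (auto simp: \<phi>_def)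
  have prey: "{x\<in>?U. \<phi> x \<in> {y}} = {y}" if "y \<in> W - X" for y using that a by (auto simp: \<phi>_def)
  note tot = admissibleD(8)[OF admissible] and bu = admissibleD(9)[OF admissible] and z0 = admissibleD(10)[OF admissible]
    and Econd = admissibleD(12)[OF admissible] and wu = admissibleD(13)[OF admissible]
  have good': "admissible K W' u E' (push b) (push s) (push w)"
    unfolding admissible_def
  proof (intro conjI ballI allI impI)
    show "finite W'" "u \<notin> W'" "2 \<le> card W'" by fact+
    show "edges_on (insert u W') E'"
      unfolding edges_on_def
    proof
      fix e' assume "e' \<in># E'"
      then obtain e where e: "e \<in># G" "e' = map_prod \<phi> \<phi> e" by (auto simp: E'_def)
      have "fst e \<in> ?U" "snd e \<in> ?U" "fst e \<noteq> snd e" using onFG(2) e(1) by (auto simp: edges_on_def)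
      moreover have "\<phi> (fst e) \<noteq> \<phi> (snd e)"
        using G e(1) a \<open>fst e \<noteq> snd e\<close> by (auto simp: \<phi>_def)
      ultimately show "fst e' \<in> ?U' \<and> snd e' \<in> ?U' \<and> fst e' \<noteq> snd e'"
        using \<phi>U e(2) by simp
    qed
    fix x assume x: "x \<in> insert u W'"
    show "\<bar>push s x\<bar> \<le> push w x" unfolding push_def
      by (rule order.trans[OF sum_abs]) (intro sum_mono, use loc in auto)
    show "even (push w x + push s x)" unfolding push_def sum.distrib[symmetric]
      by (intro dvd_sum) (use loc in auto)
    have "even (deg E w {y\<in>?U. \<phi> y \<in> {x}} + sum b {y\<in>?U. \<phi> y \<in> {x}})"
      by (rule deg_parity) (use fin loc in auto)
    then have "even (deg E' (push w) {x} + push b x)" unfolding push_one[of b] by (subst degE') auto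
    then show "even (cut E' {x} + push w x + push b x)" by (simp add: deg_def)
  next
    have "(\<Sum>x\<in>?U'. push b x - push s x) = (\<Sum>x\<in>?U. b x - s x)"
      using finW' by (simp only: sum_subtractf push_sum finite_insert allU)
    then show "2 * K dvd (\<Sum>x\<in>?U'. push b x - push s x)" using tot by simp
    show "2 * K dvd push b u" unfolding push_one preu using bu by auto
    show "sum (push w) ?U' \<le> 2 * K - 2 + nrm K (sum (push s) ?U')"
      using z0 finW' by (simp only: push_sum finite_insert allU)
    show "push w u \<le> cut E' {u}" unfolding push_one cutE' preu using wu cut_nonneg by auto
  next
    fix Y assume Y: "Y \<subseteq> ?U' \<and> Y \<inter> W' \<noteq> {} \<and> \<not> W' \<subseteq> Y"
    then have finY: "finite Y" using finW' by (auto intro: finite_subset)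
    have fixed: "z \<in> W \<and> \<phi> z = z" if "z \<in> W'" for z using that a by (auto simp: W'_def \<phi>_def)
    show "2 * K - 2 + nrm K (sum (push b) Y) \<le> deg E' (push w) Y"
      unfolding push_sum[OF finY] degE'[OF finY]
    proof (rule sets)
      show "{x \<in> insert u W. \<phi> x \<in> Y} \<subseteq> insert u W" by auto
      show "{x \<in> insert u W. \<phi> x \<in> Y} \<inter> W \<noteq> {}" using Y fixed by fastforce
      show "\<not> W \<subseteq> {x \<in> insert u W. \<phi> x \<in> Y}" using Y fixed by fastforce
    qed
  next
    fix y assume y: "y \<in> W'"
    have split: "{x\<in>?U. \<phi> x \<in> {u, y}} = {x\<in>?U. \<phi> x \<in> {u}} \<union> {x\<in>?U. \<phi> x \<in> {y}}" by auto
    show "deg E' (push w) {y} \<le> deg E' (push w) {u, y}"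
    proof (cases "u \<in> X")
      case True
      then show ?thesis by (simp only: degE' finite.intros split preu if_True Un_empty_left order.refl)
    next
      case False
      show ?thesis
      proof (cases "y = a")
        case True
        \<comment> \<open>The contracted vertex is the only one at which the condition on edges to
          \<open>u\<close> is new; \<open>uX\<close> is there to provide it.\<close>
        have "{x\<in>?U. \<phi> x \<in> {u, a}} = insert u X" using split prea preu True False by simp
        then show ?thesis using uX False True prea by (simp only: degE' finite.intros simp_thms)
      next
        case False': False
        then have "y \<in> W - X" using y by (auto simp: W'_def)
        then have "{x\<in>?U. \<phi> x \<in> {y}} = {y}" "{x\<in>?U. \<phi> x \<in> {u, y}} = {u, y}"
          using prey preu False unfolding split by auto
        moreover have "deg E w {y} \<le> deg E w {u, y}" using Econd \<open>y \<in> W - X\<close> by blast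
        ultimately show ?thesis by (simp only: degE' finite.intros)
      qed
    qed
  qed
  obtain f where f: "achievable E' f" "\<forall>x\<in>?U'. 2 * K dvd f x - (push b x - push s x)"
    using IH[OF cardlt good'] by (auto simp: solvable_def)
  obtain g where g: "achievable G g" "f = push g"
    using achievable_image[OF fin(2) onFG(2) f(1)[unfolded E'_def]] unfolding push_def by blast
  have gX: "2 * K dvd (\<Sum>x\<in>X. b x - s x - g x)"
  proof -
    have "2 * K dvd push g a - (push b a - push s a)" using f(2) g(2) by (auto simp: W'_def)
    then have "2 * K dvd sum g X - (sum b X - sum s X)" unfolding push_one prea .
    then have "2 * K dvd - (sum g X - (sum b X - sum s X))" by (rule dvd_minus_iff[THEN iffD2])
    then show ?thesis by (simp add: sum_subtractf)
  qed
  obtain h where h: "achievable F h" "\<forall>x\<in>X. 2 * K dvd h x - (b x - s x - g x)"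
    using inside[OF EFG g(1) F G gX] by (auto simp: solvable_def)
  have "achievable E (\<lambda>x. h x + g x)" unfolding EFG by (rule achievable_union[OF h(1) g(1)])
  moreover have "2 * K dvd h x + g x - (b x - s x)" if x: "x \<in> ?U" for x
  proof (cases "x \<in> X")
    case True
    then have "2 * K dvd h x - (b x - s x - g x)" using h by auto
    then show ?thesis by (simp add: algebra_simps)
  next
    case False
    have "cut F {x} = 0" unfolding cut_def by (rule sum_mset.neutral) (use F False in \<open>auto simp: crosses_def\<close>)
    then have "h x = 0" using achievable_bound[OF h(1), of x] by simp
    have "{y\<in>?U. \<phi> y \<in> {x}} = {x}" using False x a by (auto simp: \<phi>_def)
    then have "push k x = k x" for k unfolding push_one by simp
    moreover have "x \<in> ?U'" using x False by (auto simp: W'_def)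
    ultimately show ?thesis using f(2) g(2) \<open>h x = 0\<close> by auto
  qed
  ultimately show ?thesis unfolding solvable_def by blast
qed

lemma sum_dir: "finite X \<Longrightarrow> (\<Sum>x\<in>X. dir e x) = of_bool (fst e \<in> X) - of_bool (snd e \<in> X)"
  unfolding dir_def by (simp add: sum_subtractf of_bool_def sum.delta)

lemma sum_indicator: "finite X \<Longrightarrow> (\<Sum>x\<in>X. j * of_bool (x = p)) = (j :: int) * of_bool (p \<in> X)"
  by (simp add: sum_distrib_left[symmetric] of_bool_def sum.delta')

lemma solvable_uminus:
  assumes "solvable K U E (\<lambda>x. - b x - - s x)" shows "solvable K U E (\<lambda>x. b x - s x)"
proof -
  obtain f where f: "achievable E f" "\<forall>x\<in>U. 2 * K dvd f x - (- b x - - s x)"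
    using assms by (auto simp: solvable_def)
  have "2 * K dvd - f x - (b x - s x)" if "x \<in> U" for x
  proof -
    have eq: "- (f x - (- b x - - s x)) = - f x - (b x - s x)" by simp
    have "2 * K dvd - (f x - (- b x - - s x))" using f(2) that by (simp only: dvd_minus_iff)
    then show ?thesis unfolding eq .
  qed
  then show ?thesis using achievable_uminus[OF f(1)] by (auto simp: solvable_def)
qed

lemma admissible_uminus:
  assumes "K > 0" "admissible K W u E b s w" shows "admissible K W u E (\<lambda>x. - b x) (\<lambda>x. - s x) w"
proof -
  have 1: "(\<Sum>x\<in>U. - b x - - s x) = - (\<Sum>x\<in>U. b x - s x)" for U
    by (simp add: sum_subtractf sum_negf)
  show ?thesis using assms(2)
    unfolding admissible_def 1 sum_negf nrm_uminus[OF assms(1)] abs_minus_cancel dvd_minus_iff even_add even_minus .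
qed

text \<open>Inside a tight set the edges leaving it, directed by the solution of the contracted
  instance, play the role of the edges to the preoriented vertex. Tightness says that their number
  is \<open>2 * K - 2 + nrm K (sum b X)\<close>, and their total net agrees with
  \<open>sum b X\<close> modulo \<open>2 * K\<close>, so the bound on the preoriented vertex holds
  with equality. Both instances have fewer vertices.\<close>

lemma tight_contract:
  fixes W :: "'v set"
  assumes K: "2 \<le> K" and admissible: "admissible K W u E b s w"
    and X: "X \<subseteq> insert u W" "2 \<le> card (X \<inter> W)" "\<not> W \<subseteq> X"
    and tight: "deg E w X \<le> 2 * K - 2 + nrm K (sum b X)"
    and IH: "\<And>(W' :: 'v set) u' b' s' w' E'. card W' < card W \<Longrightarrow> admissible K W' u' E' b' s' w' \<Longrightarrow> solvable K (insert u' W') E' (\<lambda>x. b' x - s' x)"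
  shows "solvable K (insert u W) E (\<lambda>x. b x - s x)"
proof (rule contract[OF K admissible X])
  have fin: "finite W" "u \<notin> W" "finite X" using admissibleD(1,2)[OF admissible] X(1) finite_subset by auto
  note edges_on = admissibleD(4)[OF admissible] and sets = admissibleD(11)[OF admissible] and bu = admissibleD(9)[OF admissible]
  have bu_nrm: "nrm K (sum b (insert u Y)) = nrm K (sum b Y)" if "finite Y" for Y
    by (rule nrm_cong) (use that bu in \<open>cases "u \<in> Y"; simp add: insert_absorb\<close>)
  have XW: "X \<inter> W \<noteq> {}" using X(2) by auto
  show "u \<in> X \<or> deg E w X \<le> deg E w (insert u X)"
  proof -
    \<comment> \<open>Since \<open>b u\<close> is 0 modulo \<open>2 * K\<close>, the sets
      \<open>X\<close> and \<open>insert u X\<close> have the same lower bound, and \<open>X\<close>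
      attains it.\<close>
    have "2 * K - 2 + nrm K (sum b (insert u X)) \<le> deg E w (insert u X)"
      by (rule sets) (use X XW fin in auto)
    then show ?thesis using tight bu_nrm[OF fin(3)] by simp
  qed
  show "solvable K (insert u W') E' (\<lambda>x. b' x - s' x)"
    if "card W' < card W" "admissible K W' u E' b' s' w'" for W' b' s' w' E'
    using IH[OF that] .
  fix g F G
  assume EFG: "E = F + G" and g: "achievable G g" and F: "\<forall>e\<in>#F. fst e \<in> X \<and> snd e \<in> X"
    and G: "\<forall>e\<in>#G. \<not> (fst e \<in> X \<and> snd e \<in> X)" and gs: "2 * K dvd (\<Sum>x\<in>X. b x - s x - g x)"
  \<comment> \<open>The data are 0 outside \<open>X\<close>, so that \<open>u\<close> is a harmless
    isolated vertex of the inner instance if it does not belong to \<open>X\<close>.\<close>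
  define b2 where "b2 = (\<lambda>x. if x \<in> X then b x else 0)"
  define s2 where "s2 = (\<lambda>x. if x \<in> X then s x + g x else 0)"
  define w2 where "w2 = (\<lambda>x. if x \<in> X then w x + cut G {x} else 0)"
  let ?U2 = "insert u (X \<inter> W)"
  have XU2: "X \<subseteq> ?U2" using X(1) by auto
  have onF: "edges_on X F" using edges_on F unfolding EFG by (auto simp: edges_on_def)
  have finU2: "finite ?U2" using fin by auto
  have sum2: "sum b2 Y = sum b (Y \<inter> X)" "sum s2 Y = (\<Sum>x\<in>Y \<inter> X. s x + g x)" "sum w2 Y = (\<Sum>x\<in>Y \<inter> X. w x + cut G {x})"
    if "finite Y" for Y
    unfolding b2_def s2_def w2_def using that by (simp_all add: sum.inter_restrict)
  have deg2: "deg F w2 Y = deg E w (Y \<inter> X)" if "finite Y" for Y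
  proof -
    have "cut F Y = cut F (Y \<inter> X)" by (rule cut_cong[OF onF]) auto
    moreover have "cut G (Y \<inter> X) = (\<Sum>x\<in>Y \<inter> X. cut G {x})"
      by (rule cut_sum_independent[OF fin(3) G]) auto
    ultimately show ?thesis unfolding deg_def sum2[OF that] EFG cut_union by (simp add: sum.distrib)
  qed
  have cutF0: "cut F Y = 0" if "X \<subseteq> Y" for Y
  proof -
    have "cut F Y = cut F (X - (Y \<inter> X)) " using cut_compl[OF onF, of "Y \<inter> X"] cut_cong[OF onF, of Y "Y \<inter> X"] by auto
    also have "X - (Y \<inter> X) = {}" using that by auto
    finally show ?thesis using cut_cong[OF onF, of "{}" X] by (simp add: cut_def crosses_def)
  qed
  have degX: "deg E w X = 2 * K - 2 + nrm K (sum b X)"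
    using tight sets[of X] X XW by auto
  have sb: "nrm K (\<Sum>x\<in>X. s x + g x) = nrm K (sum b X)"
  proof (rule nrm_cong)
    have "(\<Sum>x\<in>X. b x - s x - g x) = sum b X - (\<Sum>x\<in>X. s x + g x)" by (simp add: sum_subtractf sum.distrib)
    then show "2 * K dvd (\<Sum>x\<in>X. s x + g x) - sum b X" using gs by (metis dvd_minus_iff minus_diff_eq)
  qed
  have U2X: "?U2 \<inter> X = X" using XU2 by auto
  have good2: "admissible K (X \<inter> W) u F b2 s2 w2"
    unfolding admissible_def
  proof (intro conjI ballI allI impI)
    show "finite (X \<inter> W)" "u \<notin> X \<inter> W" "2 \<le> card (X \<inter> W)" using fin X by auto
    show "edges_on ?U2 F" using onF XU2 by (auto simp: edges_on_def)
    show "2 * K dvd (\<Sum>x\<in>?U2. b2 x - s2 x)"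
    proof -
      have "(\<Sum>x\<in>?U2. b2 x - s2 x) = (\<Sum>x\<in>X. b x - s x - g x)"
        unfolding sum_subtractf sum2[OF finU2] U2X by (simp add: sum.distrib)
      then show ?thesis using gs by simp
    qed
    show "2 * K dvd b2 u" using bu by (auto simp: b2_def)
    show "sum w2 ?U2 \<le> 2 * K - 2 + nrm K (sum s2 ?U2)"
      using deg2[OF finU2] cutF0[OF XU2] sb degX unfolding sum2[OF finU2] U2X deg_def by simp
    show "w2 u \<le> cut F {u}"
    proof (cases "u \<in> X")
      case True
      \<comment> \<open>Removing \<open>u\<close> does not change the demand, so by tightness the
        degree of \<open>X - {u}\<close> is at least that of \<open>X\<close>. Hence at most half of
        the edges at \<open>u\<close> leave \<open>X\<close>.\<close>
      have "(X - {u}) \<inter> W \<noteq> {}" "\<not> W \<subseteq> X - {u}" using fin XW X by auto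
      then have "2 * K - 2 + nrm K (sum b (X - {u})) \<le> deg E w (X - {u})"
        using X fin by (intro sets) auto
      moreover have "nrm K (sum b (X - {u})) = nrm K (sum b X)"
        using bu_nrm[of "X - {u}"] fin True by (simp add: insert_absorb)
      ultimately have le: "deg E w X \<le> deg E w (X - {u})" using degX by simp
      have "cut F (X - {u}) = cut F {u}" using cut_compl[OF onF] by auto
      moreover have "cut F X = 0" using cutF0 by simp
      moreover have "cut G X = cut G (X - {u}) + cut G {u}"
        using cut_sum_independent[OF fin(3) G, of X] cut_sum_independent[OF fin(3) G, of "X - {u}"]
          sum.remove[OF fin(3) True, of "\<lambda>x. cut G {x}"] by simp
      moreover have "sum w X = w u + sum w (X - {u})" using sum.remove[OF fin(3) True, of w] by simp
      ultimately have "w u + cut G {u} \<le> cut F {u}" using le unfolding deg_def EFG cut_union by simp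
      then show ?thesis using True by (simp add: w2_def)
    next
      case False
      then show ?thesis by (simp add: w2_def cut_nonneg)
    qed
  next
    fix x assume x: "x \<in> ?U2"
    have xU: "x \<in> insert u W" using x by auto
    show "\<bar>s2 x\<bar> \<le> w2 x" using admissibleD(5)[OF admissible xU] achievable_bound[OF g, of x] by (auto simp: s2_def w2_def)
    show "even (w2 x + s2 x)" using admissibleD(6)[OF admissible xU] achievable_parity[OF g, of x] by (auto simp: s2_def w2_def)
    show "even (cut F {x} + w2 x + b2 x)"
    proof (cases "x \<in> X")
      case True
      then show ?thesis using admissibleD(7)[OF admissible xU] by (simp add: w2_def b2_def EFG cut_union algebra_simps)
    next
      case False
      have "cut F {x} = cut F {}" by (rule cut_cong[OF onF]) (use False in auto)
      then show ?thesis using False by (simp add: w2_def b2_def cut_def crosses_def)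
    qed
  next
    fix Y assume Y: "Y \<subseteq> ?U2 \<and> Y \<inter> (X \<inter> W) \<noteq> {} \<and> \<not> X \<inter> W \<subseteq> Y"
    have finY: "finite Y" using Y finU2 finite_subset by auto
    show "2 * K - 2 + nrm K (sum b2 Y) \<le> deg F w2 Y"
      unfolding deg2[OF finY] sum2[OF finY] by (rule sets) (use Y X in auto)
  next
    fix y assume y: "y \<in> X \<inter> W"
    show "deg F w2 {y} \<le> deg F w2 {u, y}"
    proof (cases "u \<in> X")
      case True
      then have "{y} \<inter> X = {y}" "{u, y} \<inter> X = {u, y}" using y by auto
      then show ?thesis using admissibleD(12)[OF admissible, of y] y by (simp add: deg2)
    next
      case False
      then have "{u, y} \<inter> X = {y} \<inter> X" by auto
      then show ?thesis by (simp add: deg2)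
    qed
  qed
  have "card (X \<inter> W) < card W" using X fin by (intro psubset_card_mono) auto
  then obtain h where h: "achievable F h" "\<forall>x\<in>?U2. 2 * K dvd h x - (b2 x - s2 x)"
    using IH[OF _ good2] by (auto simp: solvable_def)
  have "2 * K dvd h x - (b x - s x - g x)" if "x \<in> X" for x
    using h(2) XU2 that by (auto simp: b2_def s2_def algebra_simps)
  then show "solvable K X F (\<lambda>x. b x - s x - g x)" using h(1) by (auto simp: solvable_def)
qed

text \<open>Degree and \<open>nrm\<close> of the demand have equal parity, so a set that is not
  tight exceeds its bound by at least 2.\<close>

lemma slack:
  assumes K: "2 \<le> K" and admissible: "admissible K W u E b s w"
    and X: "X \<subseteq> insert u W"
    and tight: "\<not> deg E w X \<le> 2 * K - 2 + nrm K (sum b X)"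
  shows "2 * K + nrm K (sum b X) \<le> deg E w X"
proof -
  have "finite X" using X admissibleD(1)[OF admissible] finite_subset by auto
  then have "even (deg E w X + sum b X)" using admissibleD(7)[OF admissible] X by (intro deg_parity) auto
  moreover have "even (nrm K (sum b X) + sum b X)" using K by (intro nrm_parity) auto
  ultimately have "even (deg E w X + nrm K (sum b X))" by presburger
  then have "deg E w X \<noteq> 2 * K - 2 + nrm K (sum b X) + 1" by presburger
  then show ?thesis using tight by simp
qed

section \<open>Lifting edges at the exempt vertex\<close>

lemma dir_same [simp]: "dir (x, y) x = of_bool (x \<noteq> y)" "dir (x, y) y = - of_bool (x \<noteq> y)"
  by (auto simp: dir_def)

text \<open>Two edges at \<open>u\<close> leading to different vertices, one of which may be the
  preoriented vertex, are replaced by one edge between these vertices. A set loses at most 2, which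
  the slack of larger sets absorbs, and no single vertex of \<open>W\<close> loses anything. The
  choice of the pair has to preserve the condition that no vertex takes more than half of the edges
  at \<open>u\<close>.\<close>

lemma special_lift:
  assumes K: "2 \<le> K" and admissible: "admissible K W u E b s w"
    and pos: "0 < cut E {u} + w u"
    and sl: "\<And>X. X \<subseteq> insert u W \<Longrightarrow> 2 \<le> card (X \<inter> W) \<Longrightarrow> \<not> W \<subseteq> X \<Longrightarrow> 2 * K + nrm K (sum b X) \<le> deg E w X"
    and IH: "\<And>b' s' w' E'. size E' < size E \<Longrightarrow> admissible K W u E' b' s' w' \<Longrightarrow> solvable K (insert u W) E' (\<lambda>x. b' x - s' x)"
  shows "solvable K (insert u W) E (\<lambda>x. b x - s x)"
proof -
  let ?U = "insert u W"
  have fin: "finite W" "finite ?U" "u \<notin> W" using admissibleD(1,2)[OF admissible] by auto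
  note edges_on = admissibleD(4)[OF admissible] and sets = admissibleD(11)[OF admissible] and bu = admissibleD(9)[OF admissible]
    and wu = admissibleD(13)[OF admissible]
  define D where "D = cut E {u} + w u"
  have cutu: "cut E {u} = (\<Sum>y\<in>W. mult E u y)" by (rule cut_singleton_sum[OF fin(1) edges_on fin(3)])
  have evD: "even D"
  proof -
    have "even (b u)" using bu dvd_mult_left by blast
    then show ?thesis using admissibleD(7)[OF admissible, of u] unfolding D_def by simp
  qed
  have mD: "2 * mult E u y \<le> D" if "y \<in> W" for y
  proof -
    have "u \<noteq> y" using that fin by auto
    then show ?thesis using admissibleD(12)[OF admissible that] cut_insert[of u y E] by (simp add: deg_def D_def)
  qed
  have cu: "0 < cut E {u}" using pos wu by linarith
  \<comment> \<open>A neighbour that already takes exactly half of the edges at \<open>u\<close>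
    must take part in the lift, since the total \<open>D\<close> drops by 2.\<close>
  obtain a where a: "a \<in> W" "0 < mult E u a" "\<And>y. y \<in> W \<Longrightarrow> 2 * mult E u y = D \<Longrightarrow> 2 * mult E u a = D"
  proof (cases "\<exists>y\<in>W. 2 * mult E u y = D")
    case True
    then obtain y where "y \<in> W" "2 * mult E u y = D" by blast
    then show thesis using pos by (intro that[of y]) (auto simp: D_def)
  next
    case False
    obtain y where "y \<in> W" "0 < mult E u y"
    proof (rule ccontr)
      assume "\<not> thesis"
      then have "\<forall>y\<in>W. mult E u y \<le> 0" using that by force
      then have "cut E {u} \<le> 0" unfolding cutu by (intro sum_nonpos) auto
      then show False using cu by simp
    qed
    then show thesis using False by (intro that[of y]) auto
  qed
  have au: "a \<noteq> u" using a fin by auto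
  have pair: "(\<Sum>y\<in>Y. mult E u y) \<le> cut E {u}" if "Y \<subseteq> W" for Y
    unfolding cutu by (intro sum_mono2) (use fin that mult_nonneg in auto)
  \<comment> \<open>A set meeting \<open>W\<close> in one vertex \<open>y\<close> is
    \<open>{y}\<close> or \<open>{u, y}\<close>; as \<open>b u\<close> is 0 modulo
    \<open>2 * K\<close>, both follow from the bound for \<open>{y}\<close>. All other sets have
    slack 2.\<close>
  have small_sets: "2 * K - 2 + nrm K (sum b X) \<le> deg E' w' X"
    if X: "X \<subseteq> ?U" "X \<inter> W \<noteq> {}" "\<not> W \<subseteq> X"
      and big: "deg E w X - 2 \<le> deg E' w' X"
      and single: "\<And>y. y \<in> W \<Longrightarrow> deg E w {y} \<le> deg E' w' {y} \<and> deg E' w' {y} \<le> deg E' w' {u, y}"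
    for X E' w'
  proof (cases "2 \<le> card (X \<inter> W)")
    case True
    then show ?thesis using sl[OF X(1) True X(3)] big by simp
  next
    case False
    moreover have "card (X \<inter> W) \<noteq> 0" using X fin by auto
    ultimately have "card (X \<inter> W) = 1" by linarith
    then obtain y where y: "X \<inter> W = {y}" by (auto simp: card_1_singleton_iff)
    then have yW: "y \<in> W" by auto
    have "W \<noteq> {y}" using admissibleD(3)[OF admissible] by auto
    then have "2 * K - 2 + nrm K (sum b {y}) \<le> deg E w {y}" using yW by (intro sets) auto
    then have *: "2 * K - 2 + nrm K (b y) \<le> deg E' w' {y}" using single[OF yW] by simp
    have "X = {y} \<or> X = {u, y}" using y X(1) by auto
    then show ?thesis
    proof
      assume "X = {y}"
      then show ?thesis using * by simp
    next
      assume X: "X = {u, y}"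
      have "nrm K (sum b X) = nrm K (b y)" unfolding X
        by (rule nrm_cong) (use yW fin bu in \<open>cases "u = y"; auto\<close>)
      then show ?thesis using * single[OF yW] X by simp
    qed
  qed
  show ?thesis
  proof (cases "w u = 0")
    case False
    then have wu0: "0 < w u" using admissibleD(5)[OF admissible, of u] by auto
    obtain R where R: "\<And>X. cut E X = crosses X (u, a) + cut R X" "size E = Suc (size R)" "set_mset R \<subseteq> set_mset E"
      "\<And>f. achievable R f \<Longrightarrow> achievable E (\<lambda>z. f z + dir (u, a) z)"
      "\<And>f. achievable R f \<Longrightarrow> achievable E (\<lambda>z. f z - dir (u, a) z)"
      "\<And>x y. mult E x y = of_bool ((u, a) = (x, y) \<or> (u, a) = (y, x)) + mult R x y"
      by (rule take_edge[OF a(2)]) blast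
    \<comment> \<open>If some preoriented edge enters \<open>u\<close>
      (\<open>\<epsilon> = 1\<close>), the path from the preoriented vertex through \<open>u\<close>
      to \<open>a\<close> is shortcut. Otherwise all of them leave \<open>u\<close>, and the path
      from \<open>a\<close> through \<open>u\<close> to the preoriented vertex is shortcut.\<close>
    define \<epsilon> :: int where "\<epsilon> = (if s u < w u then 1 else -1)"
    define s' where "s' = (\<lambda>x. s x + \<epsilon> * dir (u, a) x)"
    define w' where "w' = (\<lambda>x. w x - dir (u, a) x)"
    have eps: "\<epsilon> = 1 \<or> \<epsilon> = -1" by (simp add: \<epsilon>_def)
    have sum_s': "sum s' X = sum s X + \<epsilon> * (of_bool (u \<in> X) - of_bool (a \<in> X))" if "finite X" for X
      unfolding s'_def using sum_dir[OF that, of "(u, a)"] by (simp add: sum.distrib sum_distrib_left[symmetric])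
    have sum_w': "sum w' X = sum w X - (of_bool (u \<in> X) - of_bool (a \<in> X))" if "finite X" for X
      unfolding w'_def using sum_dir[OF that, of "(u, a)"] by (simp add: sum_subtractf)
    have deg': "deg R w' X = deg E w X - 2 * of_bool (u \<in> X \<and> a \<notin> X)" if "finite X" for X
      unfolding deg_def sum_w'[OF that] R(1) by (auto simp: crosses_def)
    \<comment> \<open>If \<open>y\<close> took half of the edges, so would \<open>a\<close> by its
      choice, leaving none for the preoriented vertex.\<close>
    have mu: "2 * mult E u y + 2 \<le> D" if "y \<in> W" "y \<noteq> a" for y
    proof -
      have "mult E u y + mult E u a \<le> cut E {u}" using pair[of "{y, a}"] that a by auto
      then have "2 * mult E u y \<noteq> D" using a(3)[OF that(1)] wu0 unfolding D_def by linarith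
      then show ?thesis using mD[OF that(1)] evD by presburger
    qed
    have single: "deg E w {y} \<le> deg R w' {y} \<and> deg R w' {y} \<le> deg R w' {u, y}" if y: "y \<in> W" for y
    proof (cases "y = a")
      case True
      then show ?thesis using admissibleD(12)[OF admissible y] au by (simp add: deg')
    next
      case False
      have "y \<noteq> u" using y fin by auto
      then show ?thesis using False au mu[OF y False] cut_insert[of u y E] by (auto simp: deg' ) (simp add: deg_def D_def)
    qed
    have good': "admissible K W u R b s' w'"
      unfolding admissible_def
    proof (intro conjI ballI allI impI)
      show "finite W" "u \<notin> W" "2 \<le> card W" using fin admissibleD(3)[OF admissible] by auto
      show "edges_on ?U R" using edges_on R(3) by (auto simp: edges_on_def)
      have "(\<Sum>x\<in>?U. b x - s' x) = (\<Sum>x\<in>?U. b x - s x)"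
        unfolding sum_subtractf sum_s'[OF fin(2)] using a by simp
      then show "2 * K dvd (\<Sum>x\<in>?U. b x - s' x)" using admissibleD(8)[OF admissible] by simp
      show "2 * K dvd b u" by fact
      have "sum w' ?U = sum w ?U" "sum s' ?U = sum s ?U"
        unfolding sum_s'[OF fin(2)] sum_w'[OF fin(2)] using a by simp_all
      then show "sum w' ?U \<le> 2 * K - 2 + nrm K (sum s' ?U)" using admissibleD(10)[OF admissible] by simp
      show "w' u \<le> cut R {u}" using wu R(1)[of "{u}"] au by (simp add: w'_def crosses_def)
    next
      fix x assume x: "x \<in> ?U"
      have sx: "\<bar>s x\<bar> \<le> w x" "even (w x + s x)" "even (cut E {x} + w x + b x)"
        using admissibleD(5-7)[OF admissible x] by auto
      consider "x = u" | "x = a" | "x \<noteq> u" "x \<noteq> a" by blast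
      then show "\<bar>s' x\<bar> \<le> w' x"
      proof cases
        case 1
        have "s u \<noteq> w u - 1" using sx(2) unfolding 1 by presburger
        then show ?thesis using sx au wu0 1 by (auto simp: s'_def w'_def \<epsilon>_def)
      next
        case 2
        then show ?thesis using sx au by (auto simp: s'_def w'_def \<epsilon>_def)
      next
        case 3
        then show ?thesis using sx by (simp add: s'_def w'_def dir_def)
      qed
      show "even (w' x + s' x)" using sx(2) eps by (auto simp: s'_def w'_def)
      have "even (crosses {x} (u, a) + dir (u, a) x)" by (auto simp: crosses_def dir_def)
      then show "even (cut R {x} + w' x + b x)" using sx(3) R(1)[of "{x}"] unfolding w'_def by simp presburger
    next
      fix X assume X: "X \<subseteq> ?U \<and> X \<inter> W \<noteq> {} \<and> \<not> W \<subseteq> X"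
      then have finX: "finite X" using fin finite_subset by auto
      show "2 * K - 2 + nrm K (sum b X) \<le> deg R w' X"
        by (rule small_sets) (use X single deg'[OF finX] in auto)
    next
      fix y assume "y \<in> W"
      then show "deg R w' {y} \<le> deg R w' {u, y}" using single by blast
    qed
    obtain f where f: "achievable R f" "\<forall>x\<in>?U. 2 * K dvd f x - (b x - s' x)"
      using IH[OF _ good'] R(2) by (auto simp: solvable_def)
    have "achievable E (\<lambda>z. f z + \<epsilon> * dir (u, a) z)" using R(4,5)[OF f(1)] eps by auto
    moreover have "2 * K dvd f x + \<epsilon> * dir (u, a) x - (b x - s x)" if "x \<in> ?U" for x
      using f(2) that by (auto simp: s'_def algebra_simps)
    ultimately show ?thesis unfolding solvable_def by blast
  next
    case True
    \<comment> \<open>At most half of the edges at \<open>u\<close> go to \<open>a\<close>, and none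
      go to the preoriented vertex, so there is a second neighbour.\<close>
    obtain c where c: "c \<in> W" "c \<noteq> a" "0 < mult E u c"
    proof (rule ccontr)
      assume "\<not> thesis"
      then have "\<forall>y\<in>W - {a}. mult E u y \<le> 0" using that by force
      then have "(\<Sum>y\<in>W - {a}. mult E u y) \<le> 0" by (intro sum_nonpos) auto
      then have "cut E {u} \<le> mult E u a" using sum.remove[OF fin(1) a(1), of "mult E u"] cutu by simp
      then show False using mD[OF a(1)] a(2) True by (simp add: D_def)
    qed
    have cu: "c \<noteq> u" using c fin by auto
    obtain R where R: "\<And>X. cut E X = crosses X (u, a) + cut R X" "size E = Suc (size R)" "set_mset R \<subseteq> set_mset E"
      "\<And>f. achievable R f \<Longrightarrow> achievable E (\<lambda>z. f z + dir (u, a) z)"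
      "\<And>f. achievable R f \<Longrightarrow> achievable E (\<lambda>z. f z - dir (u, a) z)"
      "\<And>x y. mult E x y = of_bool ((u, a) = (x, y) \<or> (u, a) = (y, x)) + mult R x y"
      by (rule take_edge[OF a(2)]) blast
    have "0 < mult R u c" using c R(6)[of u c] cu by auto
    then obtain Q where Q: "\<And>X. cut R X = crosses X (u, c) + cut Q X" "size R = Suc (size Q)" "set_mset Q \<subseteq> set_mset R"
      "\<And>f. achievable Q f \<Longrightarrow> achievable R (\<lambda>z. f z + dir (u, c) z)"
      "\<And>f. achievable Q f \<Longrightarrow> achievable R (\<lambda>z. f z - dir (u, c) z)"
      by (rule take_edge) blast
    define E' where "E' = add_mset (a, c) Q"
    have cut': "cut E' X = cut E X - 2 * of_bool (u \<in> X \<and> a \<notin> X \<and> c \<notin> X \<or> u \<notin> X \<and> a \<in> X \<and> c \<in> X)" for X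
      using R(1)[of X] Q(1)[of X] by (auto simp: E'_def crosses_def)
    have deg': "deg E' w X = deg E w X - 2 * of_bool (u \<in> X \<and> a \<notin> X \<and> c \<notin> X \<or> u \<notin> X \<and> a \<in> X \<and> c \<in> X)" for X
      unfolding deg_def cut' by simp
    have mu: "2 * mult E u y + 2 \<le> D" if "y \<in> W" "y \<noteq> a" "y \<noteq> c" for y
    proof -
      have "mult E u y + mult E u a + mult E u c \<le> cut E {u}" using pair[of "{y, a, c}"] that a c by auto
      then have "2 * mult E u y \<noteq> D" using a(3)[OF that(1)] c True unfolding D_def by linarith
      then show ?thesis using mD[OF that(1)] evD by presburger
    qed
    have single: "deg E w {y} \<le> deg E' w {y} \<and> deg E' w {y} \<le> deg E' w {u, y}" if y: "y \<in> W" for y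
    proof (cases "y = a \<or> y = c")
      case True
      then show ?thesis using admissibleD(12)[OF admissible y] au cu c by (auto simp: deg')
    next
      case False
      have "y \<noteq> u" using y fin by auto
      then show ?thesis using False au cu c mu[OF y] cut_insert[of u y E] by (auto simp: deg') (simp add: deg_def D_def)
    qed
    have good': "admissible K W u E' b s w"
      unfolding admissible_def
    proof (intro conjI ballI allI impI)
      show "finite W" "u \<notin> W" "2 \<le> card W" using fin admissibleD(3)[OF admissible] by auto
      show "edges_on ?U E'" using edges_on R(3) Q(3) a c by (auto simp: edges_on_def E'_def)
      show "2 * K dvd (\<Sum>x\<in>?U. b x - s x)" "2 * K dvd b u" "sum w ?U \<le> 2 * K - 2 + nrm K (sum s ?U)"
        using admissibleD(8-10)[OF admissible] by auto
      show "w u \<le> cut E' {u}" unfolding True by (rule cut_nonneg)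
    next
      fix x assume x: "x \<in> ?U"
      show "\<bar>s x\<bar> \<le> w x" "even (w x + s x)" using admissibleD(5,6)[OF admissible x] by auto
      show "even (cut E' {x} + w x + b x)" using admissibleD(7)[OF admissible x] unfolding cut' by auto
    next
      fix X assume X: "X \<subseteq> ?U \<and> X \<inter> W \<noteq> {} \<and> \<not> W \<subseteq> X"
      show "2 * K - 2 + nrm K (sum b X) \<le> deg E' w X"
        by (rule small_sets) (use X single deg' in auto)
    next
      fix y assume "y \<in> W"
      then show "deg E' w {y} \<le> deg E' w {u, y}" using single by blast
    qed
    obtain f where f: "achievable E' f" "\<forall>x\<in>?U. 2 * K dvd f x - (b x - s x)"
      using IH[OF _ good'] R(2) Q(2) by (auto simp: solvable_def E'_def)
    obtain g where g: "achievable Q g" "f = (\<lambda>x. g x + dir (a, c) x) \<or> f = (\<lambda>x. g x - dir (a, c) x)"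
      using f(1) unfolding E'_def by (blast elim: achievable_addE)
    \<comment> \<open>An edge from \<open>a\<close> to \<open>c\<close> expands to the path from
      \<open>a\<close> through \<open>u\<close> to \<open>c\<close>, which leaves the net at
      \<open>u\<close> unchanged.\<close>
    have dirs: "dir (a, c) x = dir (u, c) x - dir (u, a) x" for x by (simp add: dir_def)
    have "achievable E (\<lambda>z. g z + dir (u, c) z - dir (u, a) z)" "achievable E (\<lambda>z. g z - dir (u, c) z + dir (u, a) z)"
      using R(5)[OF Q(4)[OF g(1)]] R(4)[OF Q(5)[OF g(1)]] by auto
    then have "achievable E f" using g(2) unfolding dirs by (auto simp: algebra_simps)
    then show ?thesis using f(2) unfolding solvable_def by blast
  qed
qed

section \<open>Instances whose exempt vertex has no edges\<close>

definition isolated :: "int \<Rightarrow> 'v set \<Rightarrow> 'v \<Rightarrow> ('v \<times> 'v) multiset \<Rightarrow> ('v \<Rightarrow> int) \<Rightarrow> ('v \<Rightarrow> int) \<Rightarrow> ('v \<Rightarrow> int) \<Rightarrow> bool" where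
  "isolated K W u E b s w \<longleftrightarrow>
     finite W \<and> u \<notin> W \<and> 2 \<le> card W \<and> edges_on W E \<and> w u = 0 \<and> s u = 0 \<and> 2 * K dvd b u \<and>
     (\<forall>x\<in>W. \<bar>s x\<bar> \<le> w x \<and> even (w x + s x) \<and> even (cut E {x} + w x + b x)) \<and>
     2 * K dvd (\<Sum>x\<in>W. b x - s x) \<and>
     sum w W \<le> 2 * K - 2 + nrm K (sum s W) \<and>
     (\<forall>X. X \<subseteq> W \<and> X \<noteq> {} \<and> X \<noteq> W \<longrightarrow> 2 * K - 2 + nrm K (sum b X) \<le> deg E w X)"

lemma isolatedD:
  assumes "isolated K W u E b s w"
  shows "finite W" "u \<notin> W" "2 \<le> card W" "edges_on W E" "w u = 0" "s u = 0" "2 * K dvd b u"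
    "\<And>x. x \<in> W \<Longrightarrow> \<bar>s x\<bar> \<le> w x"
    "\<And>x. x \<in> W \<Longrightarrow> even (w x + s x)"
    "\<And>x. x \<in> W \<Longrightarrow> even (cut E {x} + w x + b x)"
    "2 * K dvd (\<Sum>x\<in>W. b x - s x)"
    "sum w W \<le> 2 * K - 2 + nrm K (sum s W)"
    "\<And>X. X \<subseteq> W \<Longrightarrow> X \<noteq> {} \<Longrightarrow> X \<noteq> W \<Longrightarrow> 2 * K - 2 + nrm K (sum b X) \<le> deg E w X"
  using assms unfolding isolated_def by blast+

text \<open>The vertex \<open>u\<close> is kept as a placeholder that adds nothing to any cut and
  only a multiple of \<open>2 * K\<close> to any demand, so that the reductions stay within the
  instances covered by the induction.\<close>

lemma isolated_imp_admissible:
  assumes isolated: "isolated K W u E b s w" shows "admissible K W u E b s w"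
  unfolding admissible_def
proof (intro conjI ballI allI impI)
  note d = isolatedD[OF isolated]
  have edges_on: "edges_on (insert u W) E" using d(4) by (auto simp: edges_on_def)
  show "edges_on (insert u W) E" by fact
  show "finite W" "u \<notin> W" "2 \<le> card W" "2 * K dvd b u" by fact+
  have cutu: "cut E {u} = 0"
    using cut_cong[OF d(4), of "{u}" "{}"] d(2) by (simp add: cut_def crosses_def)
  show "w u \<le> cut E {u}" using d(5) cut_nonneg by simp
  show "2 * K dvd (\<Sum>x\<in>insert u W. b x - s x)" using d by simp
  show "sum w (insert u W) \<le> 2 * K - 2 + nrm K (sum s (insert u W))" using d by simp
  fix x assume x: "x \<in> insert u W"
  have "even (b u)" using d(7) dvd_mult_left by blast
  then show "\<bar>s x\<bar> \<le> w x" "even (w x + s x)" "even (cut E {x} + w x + b x)"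
    using d(5,6) d(8-10)[of x] x cutu by auto
next
  note d = isolatedD[OF isolated]
  fix y assume "y \<in> W"
  have "cut E {u, y} = cut E {y}" by (rule cut_cong[OF d(4)]) (use d(2) in auto)
  then show "deg E w {y} \<le> deg E w {u, y}" using \<open>y \<in> W\<close> d(2,5) by (cases "u = y") (simp_all add: deg_def)
next
  note d = isolatedD[OF isolated]
  fix X assume X: "X \<subseteq> insert u W \<and> X \<inter> W \<noteq> {} \<and> \<not> W \<subseteq> X"
  have c: "cut E X = cut E (X \<inter> W)" by (rule cut_cong[OF d(4)]) auto
  have "2 * K - 2 + nrm K (sum b (X \<inter> W)) \<le> deg E w (X \<inter> W)" using X by (intro d(13)) auto
  moreover have "deg E w X = deg E w (X \<inter> W) \<and> nrm K (sum b X) = nrm K (sum b (X \<inter> W))"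
  proof (cases "u \<in> X")
    case True
    have fin: "finite (X \<inter> W)" "u \<notin> X \<inter> W" using d by auto
    have "X = insert u (X \<inter> W)" using X True by auto
    then have s: "sum b X = b u + sum b (X \<inter> W)" "sum w X = w u + sum w (X \<inter> W)"
      using sum.insert[OF fin, of b] sum.insert[OF fin, of w] by simp_all
    have "nrm K (sum b X) = nrm K (sum b (X \<inter> W))"
      by (rule nrm_cong) (use s d(7) in simp)
    then show ?thesis using s c d(5) by (simp add: deg_def)
  next
    case False
    then have "X \<inter> W = X" using X by auto
    then show ?thesis by simp
  qed
  ultimately show "2 * K - 2 + nrm K (sum b X) \<le> deg E w X" by simp
qed

lemma admissible_imp_isolated:
  assumes admissible: "admissible K W u E b s w" and 0: "cut E {u} + w u = 0"
  shows "isolated K W u E b s w"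
proof -
  note g = admissibleD[OF admissible]
  have wu: "w u = 0" "cut E {u} = 0" using 0 g(5)[of u] cut_nonneg[of E "{u}"] by auto
  then have su: "s u = 0" using g(5)[of u] by simp
  have "edges_on W E" unfolding edges_on_def
  proof
    fix e assume e: "e \<in># E"
    then obtain R where "E = add_mset e R" by (metis multi_member_split)
    moreover have "0 \<le> crosses {u} e" by (simp add: crosses_def)
    ultimately have "crosses {u} e = 0" using wu(2) cut_nonneg[of R "{u}"] by simp
    moreover have "fst e \<in> insert u W" "snd e \<in> insert u W" "fst e \<noteq> snd e" using g(4) e by (auto simp: edges_on_def)
    ultimately show "fst e \<in> W \<and> snd e \<in> W \<and> fst e \<noteq> snd e" by (auto simp: crosses_def)
  qed
  moreover have "2 * K dvd (\<Sum>x\<in>W. b x - s x)"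
    using g(1,2,8,9) su by (simp add: dvd_add_right_iff)
  moreover have "sum w W \<le> 2 * K - 2 + nrm K (sum s W)" using g(1,2,10) su wu by simp
  moreover have "2 * K - 2 + nrm K (sum b X) \<le> deg E w X" if "X \<subseteq> W" "X \<noteq> {}" "X \<noteq> W" for X
    by (rule g(11)) (use that in auto)
  ultimately show ?thesis unfolding isolated_def using g(1-3,5-7,9) wu su by simp
qed

lemma isolated_solvable:
  assumes isolated: "isolated K W u E b s w" and "solvable K W E (\<lambda>x. b x - s x)"
  shows "solvable K (insert u W) E (\<lambda>x. b x - s x)"
proof -
  note d = isolatedD[OF isolated]
  obtain f where f: "achievable E f" "\<forall>x\<in>W. 2 * K dvd f x - (b x - s x)" using assms(2) by (auto simp: solvable_def)
  have "cut E {u} = 0"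
    using cut_cong[OF d(4), of "{u}" "{}"] d(2) by (simp add: cut_def crosses_def)
  then have "f u = 0" using achievable_bound[OF f(1), of u] by simp
  then have "\<forall>x\<in>insert u W. 2 * K dvd f x - (b x - s x)" using f(2) d(6,7) by simp
  then show ?thesis using f(1) by (auto simp: solvable_def)
qed

section \<open>Parallel edges, small cuts and vertices of demand 0\<close>

text \<open>With \<open>c\<close> parallel edges the nets at \<open>x\<close> are \<open>c\<close>,
  \<open>c - 2\<close>, ..., \<open>- c\<close>. If \<open>c\<close> is at least
  \<open>K - 1\<close>, these include \<open>K\<close> consecutive values of one parity, hence every
  residue modulo \<open>2 * K\<close> of that parity. The net at \<open>y\<close> is then right
  because the demands add up to 0.\<close>

lemma parallel_solvable:
  assumes K: "2 \<le> K" and E: "edges_on {x, y} E" and xy: "x \<noteq> y" and le: "K - 1 \<le> cut E {x}"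
    and c: "2 * K dvd c x + c y" "even (c x + cut E {x})"
  shows "solvable K {x, y} E c"
proof -
  obtain m where m: "cut E {x} - c x = 2 * m" using c(2) by (metis even_add even_diff evenE)
  have "0 \<le> m mod K" "m mod K < K" using K by simp_all
  then have "0 \<le> m mod K" "m mod K \<le> cut E {x}" using le by linarith+
  moreover have "\<forall>e\<in>#E. fst e = snd e \<or> e = (x, y) \<or> e = (y, x)" using E by (auto simp: edges_on_def prod_eq_iff)
  ultimately obtain h where h: "achievable E h" "h x = cut E {x} - 2 * (m mod K)" "h y = - (cut E {x} - 2 * (m mod K))"
    using achievable_parallel[of E x y "m mod K"] xy by blast
  have "m - m mod K = K * (m div K)" by (simp add: minus_mod_eq_mult_div)
  then have hx: "h x - c x = 2 * K * (m div K)" using h(2) m by simp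
  have "h y - c y = - (h x - c x) - (c x + c y)" using h by simp
  moreover have "2 * K dvd - (h x - c x) - (c x + c y)" unfolding hx using c(1) by (intro dvd_diff) auto
  ultimately have "2 * K dvd h y - c y" by simp
  moreover have "2 * K dvd h x - c x" using hx by simp
  ultimately show ?thesis using h(1) unfolding solvable_def by auto
qed

text \<open>The degrees of \<open>A\<close> and \<open>W - A\<close> together count the cut twice
  and every edge to the preoriented vertex once. The bound on the latter and the triangle inequality
  for \<open>nrm\<close> leave at least \<open>2 * K - 2\<close> for twice the cut.\<close>

lemma isolated_cut:
  assumes K: "2 \<le> K" and isolated: "isolated K W u E b s w" and A: "A \<subseteq> W" "A \<noteq> {}" "A \<noteq> W"
  shows "K - 1 \<le> cut E A"
proof -
  note d = isolatedD[OF isolated]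
  have finA: "finite A" using A d(1) finite_subset by auto
  have sp: "sum f W = sum f A + sum f (W - A)" for f :: "'a \<Rightarrow> int"
    using sum.subset_diff[OF A(1) d(1), of f] by simp
  have c: "cut E (W - A) = cut E A" using cut_compl[OF d(4)] .
  have 1: "2 * K - 2 + nrm K (sum b A) \<le> deg E w A" using A by (intro d(13)) auto
  have 2: "2 * K - 2 + nrm K (sum b (W - A)) \<le> deg E w (W - A)" using A by (intro d(13)) auto
  have 3: "nrm K (sum s W) \<le> nrm K (sum b A) + nrm K (sum b (W - A))"
  proof -
    have "nrm K (sum s W) = nrm K (sum b W)"
      using d(11) nrm_cong[of K "sum b W" "sum s W"] by (simp add: sum_subtractf)
    then show ?thesis unfolding sp[of b] using nrm_triangle[of K] K by simp
  qed
  show ?thesis using 1 2 3 d(12) c sp[of w] unfolding deg_def by linarith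
qed

lemma isolated_edge:
  assumes K: "2 \<le> K" and isolated: "isolated K W u E b s w" and A: "A \<subseteq> W" "A \<noteq> {}" "A \<noteq> W"
  shows "\<exists>x\<in>A. \<exists>y\<in>W - A. mult E x y > 0"
proof -
  note d = isolatedD[OF isolated]
  have "cut E (A \<union> (W - A)) = 0"
    using cut_compl[OF d(4), of W] A(1) by (simp add: Un_absorb1 cut_def crosses_def)
  moreover have "cut E (W - A) = cut E A" using cut_compl[OF d(4)] .
  ultimately show ?thesis
    using isolated_cut[OF K isolated A] K by (intro edge_between) auto
qed

lemma two_vertices:
  assumes K: "2 \<le> K" and isolated: "isolated K W u E b s w" and W: "card W = 2"
  shows "solvable K (insert u W) E (\<lambda>x. b x - s x)"
proof (rule isolated_solvable[OF isolated])
  note d = isolatedD[OF isolated]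
  obtain x y where xy: "W = {x, y}" "x \<noteq> y" using W by (metis card_2_iff)
  show "solvable K W E (\<lambda>x. b x - s x)" unfolding xy(1)
  proof (rule parallel_solvable[OF K _ xy(2)])
    show "edges_on {x, y} E" using d(4) xy by simp
    show "K - 1 \<le> cut E {x}" using xy by (intro isolated_cut[OF K isolated]) auto
    show "2 * K dvd b x - s x + (b y - s y)" using d(11) xy by simp
    show "even (b x - s x + cut E {x})" using d(9,10)[of x] xy by simp presburger
  qed
qed

text \<open>No tightness is required here: \<open>K - 1\<close> parallel edges meet whatever demand
  the solution of the contracted instance leaves over at \<open>x\<close> and
  \<open>y\<close>.\<close>

lemma parallel_contract:
  fixes W :: "'v set"
  assumes K: "2 \<le> K" and isolated: "isolated K W u E b s w" and W: "3 \<le> card W"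
    and xy: "x \<in> W" "y \<in> W" "x \<noteq> y" and m: "K - 1 \<le> mult E x y"
    and IH: "\<And>(W' :: 'v set) u' b' s' w' E'. card W' < card W \<Longrightarrow> admissible K W' u' E' b' s' w' \<Longrightarrow> solvable K (insert u' W') E' (\<lambda>x. b' x - s' x)"
  shows "solvable K (insert u W) E (\<lambda>x. b x - s x)"
proof (rule contract[OF K isolated_imp_admissible[OF isolated], of "{x, y}"])
  note d = isolatedD[OF isolated]
  have "{x, y} \<inter> W = {x, y}" using xy by auto
  then show "2 \<le> card ({x, y} \<inter> W)" using xy by simp
  show "{x, y} \<subseteq> insert u W" using xy by auto
  show "\<not> W \<subseteq> {x, y}"
  proof
    assume "W \<subseteq> {x, y}"
    then have "card W \<le> card {x, y}" by (intro card_mono) auto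
    then show False using W xy by simp
  qed
  have "cut E (insert u {x, y}) = cut E {x, y}" by (rule cut_cong[OF d(4)]) (use d(2) in auto)
  moreover have "u \<notin> {x, y}" using xy d(2) by auto
  ultimately show "u \<in> {x, y} \<or> deg E w {x, y} \<le> deg E w (insert u {x, y})"
    using d(5) by (simp add: deg_def)
  show "solvable K (insert u W') E' (\<lambda>x. b' x - s' x)"
    if "card W' < card W" "admissible K W' u E' b' s' w'" for W' b' s' w' E'
    using IH[OF that] .
  fix g F G
  assume EFG: "E = F + G" and g: "achievable G g" and F: "\<forall>e\<in>#F. fst e \<in> {x, y} \<and> snd e \<in> {x, y}"
    and G: "\<forall>e\<in>#G. \<not> (fst e \<in> {x, y} \<and> snd e \<in> {x, y})" and gs: "2 * K dvd (\<Sum>z\<in>{x, y}. b z - s z - g z)"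
  have onF: "edges_on {x, y} F" using F d(4) unfolding EFG by (auto simp: edges_on_def)
  show "solvable K {x, y} F (\<lambda>z. b z - s z - g z)"
  proof (rule parallel_solvable[OF K onF xy(3)])
    have "mult G x y = 0" unfolding mult_def by (rule sum_mset.neutral) (use G in auto)
    moreover have "mult E x y = mult F x y + mult G x y" unfolding EFG mult_def by simp
    moreover have "cut F {x} = mult F x y"
    proof -
      have "cut F {x} = (\<Sum>z\<in>{y}. mult F x z)" by (rule cut_singleton_sum) (use onF xy in auto)
      then show ?thesis by simp
    qed
    ultimately show "K - 1 \<le> cut F {x}" using m by simp
    show "2 * K dvd b x - s x - g x + (b y - s y - g y)" using gs xy(3) by simp
    have "even (g x + cut G {x})" by (rule achievable_parity[OF g])
    then show "even (b x - s x - g x + cut F {x})"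
      using d(9,10)[OF xy(1)] unfolding EFG cut_union by simp presburger
  qed
qed

text \<open>The vertex \<open>x\<close> leaves \<open>W\<close> and becomes the exempt vertex in
  place of \<open>u\<close>. Its degree is at least \<open>2 * K - 2\<close>, so no bundle of at
  most \<open>K - 1\<close> edges exceeds half of it.\<close>

lemma zero_special:
  assumes K: "2 \<le> K" and isolated: "isolated K W u E b s w" and W: "3 \<le> card W"
    and sl: "\<And>X. X \<subseteq> W \<Longrightarrow> 2 \<le> card X \<Longrightarrow> X \<noteq> W \<Longrightarrow> 2 * K + nrm K (sum b X) \<le> deg E w X"
    and m: "\<And>x y. x \<in> W \<Longrightarrow> y \<in> W \<Longrightarrow> x \<noteq> y \<Longrightarrow> mult E x y \<le> K - 1"
    and x: "x \<in> W" "2 * K dvd b x"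
  shows "admissible K (W - {x}) x E b s w"
  unfolding admissible_def
proof (intro conjI ballI allI impI)
  note d = isolatedD[OF isolated]
  have ins: "insert x (W - {x}) = W" using x by auto
  have cW: "card (W - {x}) = card W - 1" using x d(1) by simp
  have degx: "2 * K - 2 \<le> deg E w {x}"
  proof -
    have "2 * K - 2 + nrm K (sum b {x}) \<le> deg E w {x}" by (rule d(13)) (use x W in auto)
    then show ?thesis using nrm_nonneg[of K "b x"] K by simp
  qed
  show "finite (W - {x})" "x \<notin> W - {x}" "2 \<le> card (W - {x})" "edges_on (insert x (W - {x})) E"
    using d(1,4) W cW ins by auto
  show "2 * K dvd (\<Sum>x\<in>insert x (W - {x}). b x - s x)" "2 * K dvd b x"
    "sum w (insert x (W - {x})) \<le> 2 * K - 2 + nrm K (sum s (insert x (W - {x})))"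
    unfolding ins using d x by auto
  show "w x \<le> cut E {x}"
  proof -
    \<comment> \<open>The complement \<open>W - {x}\<close> has the same demand as \<open>W\<close>
      but slack 2. Its degree therefore exceeds the total number of preoriented edges, which means
      that \<open>x\<close> sends more edges to \<open>W\<close> than to the preoriented
      vertex.\<close>
    have 1: "2 * K + nrm K (sum b (W - {x})) \<le> deg E w (W - {x})"
      using W cW x by (intro sl) auto
    have 2: "cut E (W - {x}) = cut E {x}" using cut_compl[OF d(4)] .
    have 3: "sum f W = f x + sum f (W - {x})" for f :: "'a \<Rightarrow> int" using sum.remove[OF d(1) x(1)] .
    have "nrm K (sum s W) = nrm K (sum b W)"
      using d(11) nrm_cong[of K "sum b W" "sum s W"] by (simp add: sum_subtractf)
    also have "\<dots> = nrm K (sum b (W - {x}))" by (rule nrm_cong) (use 3[of b] x in simp)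
    finally show ?thesis using 1 2 3[of w] d(12) unfolding deg_def by linarith
  qed
  show "2 * K - 2 + nrm K (sum b X) \<le> deg E w X"
    if "X \<subseteq> insert x (W - {x}) \<and> X \<inter> (W - {x}) \<noteq> {} \<and> \<not> W - {x} \<subseteq> X" for X
    by (rule d(13)) (use that ins in auto)
  show "deg E w {y} \<le> deg E w {x, y}" if "y \<in> W - {x}" for y
    using that m[of x y] x degx cut_insert[of x y E] by (auto simp: deg_def)
  show "\<bar>s z\<bar> \<le> w z" "even (w z + s z)" "even (cut E {z} + w z + b z)" if "z \<in> insert x (W - {x})" for z
    using that d(8-10)[of z] ins by auto
qed

section \<open>Reductions by a single edge\<close>

text \<open>The common form of the reductions at an isolated \<open>u\<close>: by the slack of the larger sets,
  only singletons need to be controlled exactly.\<close>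

lemma isolated_step:
  assumes K: "2 \<le> K" and isolated: "isolated K W u E b s w"
    and sl: "\<And>X. X \<subseteq> W \<Longrightarrow> 2 \<le> card X \<Longrightarrow> X \<noteq> W \<Longrightarrow> 2 * K + nrm K (sum b X) \<le> deg E w X"
    and E': "edges_on W E'" "w' u = 0" "s' u = 0" "b' u = b u"
    and loc: "\<And>x. x \<in> W \<Longrightarrow> \<bar>s' x\<bar> \<le> w' x" "\<And>x. x \<in> W \<Longrightarrow> even (w' x + s' x)"
      "\<And>x. x \<in> W \<Longrightarrow> even (cut E' {x} + w' x + b' x)"
    and tot: "(\<Sum>x\<in>W. b' x - s' x) = (\<Sum>x\<in>W. b x - s x)"
    and z0: "sum w' W \<le> 2 * K - 2 + nrm K (sum s' W)"
    and single: "\<And>x. x \<in> W \<Longrightarrow> deg E w {x} - nrm K (b x) \<le> deg E' w' {x} - nrm K (b' x)"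
    and loss: "\<And>X. X \<subseteq> W \<Longrightarrow> deg E w X - nrm K (sum b X) - 2 \<le> deg E' w' X - nrm K (sum b' X)"
  shows "isolated K W u E' b' s' w'"
proof -
  note d = isolatedD[OF isolated]
  have "2 * K - 2 + nrm K (sum b' X) \<le> deg E' w' X" if X: "X \<subseteq> W" "X \<noteq> {}" "X \<noteq> W" for X
  proof (cases "2 \<le> card X")
    case True
    then show ?thesis using sl[OF X(1) True X(3)] loss[OF X(1)] by simp
  next
    case False
    have "finite X" using X d(1) finite_subset by auto
    then have "card X \<noteq> 0" using X by auto
    then have "card X = 1" using False by linarith
    then obtain x where "X = {x}" by (auto simp: card_1_singleton_iff)
    then show ?thesis using d(13)[OF X] single[of x] X by simp
  qed
  then show ?thesis unfolding isolated_def using assms d by auto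
qed

lemma crosses_eq_sum_dir: "finite X \<Longrightarrow> crosses X e = \<bar>\<Sum>x\<in>X. dir e x\<bar>"
  by (auto simp: sum_dir crosses_def)

text \<open>Orient an edge from \<open>x\<close> to \<open>y\<close> and delete it. The conditions on \<open>nrm\<close> say that the demand is
  positive at \<open>x\<close> and negative at \<open>y\<close>, where \<open>K\<close> counts as both.\<close>

lemma isolated_orient:
  assumes K: "2 \<le> K" and isolated: "isolated K W u E b s w"
    and sl: "\<And>X. X \<subseteq> W \<Longrightarrow> 2 \<le> card X \<Longrightarrow> X \<noteq> W \<Longrightarrow> 2 * K + nrm K (sum b X) \<le> deg E w X"
    and xy: "x \<in> W" "y \<in> W" "x \<noteq> y" "0 < mult E x y"
    and x: "nrm K (b x - 1) = nrm K (b x) - 1" and y: "nrm K (b y + 1) = nrm K (b y) - 1"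
    and IH: "\<And>b' s' w' E'. size E' < size E \<Longrightarrow> admissible K W u E' b' s' w' \<Longrightarrow> solvable K (insert u W) E' (\<lambda>x. b' x - s' x)"
  shows "solvable K (insert u W) E (\<lambda>x. b x - s x)"
proof -
  note d = isolatedD[OF isolated]
  obtain R where R: "\<And>X. cut E X = crosses X (x, y) + cut R X" "size E = Suc (size R)" "set_mset R \<subseteq> set_mset E"
      "\<And>f. achievable R f \<Longrightarrow> achievable E (\<lambda>z. f z + dir (x, y) z)"
    by (rule take_edge[OF xy(4)]) blast
  define b' where "b' = (\<lambda>z. b z - dir (x, y) z)"
  have fin: "finite X" if "X \<subseteq> W" for X using that d(1) finite_subset by auto
  have sum_b': "sum b' X = sum b X - (\<Sum>z\<in>X. dir (x, y) z)" for X
    unfolding b'_def by (simp add: sum_subtractf)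
  have deg': "deg R w X = deg E w X - crosses X (x, y)" for X unfolding deg_def R(1) by simp
  have K0: "K > 0" using K by simp
  have "isolated K W u R b' s w"
  proof (rule isolated_step[OF K isolated sl])
    show "edges_on W R" using d(4) R(3) by (auto simp: edges_on_def)
    show "w u = 0" "s u = 0" by fact+
    show "b' u = b u" using xy d(2) by (auto simp: b'_def dir_def)
    show "(\<Sum>x\<in>W. b' x - s x) = (\<Sum>x\<in>W. b x - s x)"
      unfolding sum_subtractf sum_b' sum_dir[OF d(1)] using xy by simp
    show "sum w W \<le> 2 * K - 2 + nrm K (sum s W)" by (rule d(12))
    fix z assume z: "z \<in> W"
    show "\<bar>s z\<bar> \<le> w z" "even (w z + s z)" using d(8,9)[OF z] by auto
    have "even (crosses {z} (x, y) + dir (x, y) z)" by (auto simp: crosses_def dir_def)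
    then show "even (cut R {z} + w z + b' z)" using d(10)[OF z] R(1)[of "{z}"] unfolding b'_def by simp presburger
    show "deg E w {z} - nrm K (b z) \<le> deg R w {z} - nrm K (b' z)"
      unfolding deg' using x y xy(3) by (auto simp: b'_def crosses_def dir_def)
  next
    fix X assume X: "X \<subseteq> W"
    \<comment> \<open>A set separating \<open>x\<close> from \<open>y\<close> loses one edge and may
      gain one unit of \<open>nrm\<close>, a loss of 2 in total; at \<open>x\<close> and at
      \<open>y\<close> themselves \<open>nrm\<close> drops, so there the lost edge is paid
      for.\<close>
    have "nrm K (sum b' X) \<le> nrm K (sum b X) + crosses X (x, y)"
    proof (cases "crosses X (x, y) = 0")
      case True
      then show ?thesis unfolding sum_b' using crosses_eq_sum_dir[OF fin[OF X], of "(x, y)"] by simp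
    next
      case False
      then have "crosses X (x, y) = 1" by (auto simp: crosses_def)
      then show ?thesis using crosses_eq_sum_dir[OF fin[OF X], of "(x, y)"] nrm_shift[OF K0, of "sum b' X" "sum b X"]
        unfolding sum_b' by simp
    qed
    moreover have "crosses X (x, y) \<le> 1" by (auto simp: crosses_def)
    ultimately show "deg E w X - nrm K (sum b X) - 2 \<le> deg R w X - nrm K (sum b' X)"
      unfolding deg' by linarith
  qed
  then have "admissible K W u R b' s w" by (rule isolated_imp_admissible)
  then have "solvable K (insert u W) R (\<lambda>x. b' x - s x)" by (intro IH) (simp add: R(2))
  then obtain f where f: "achievable R f" "\<forall>z\<in>insert u W. 2 * K dvd f z - (b' z - s z)"
    unfolding solvable_def by blast
  have "\<forall>z\<in>insert u W. 2 * K dvd (f z + dir (x, y) z) - (b z - s z)"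
    using f(2) by (auto simp: b'_def algebra_simps)
  then show ?thesis using R(4)[OF f(1)] unfolding solvable_def by blast
qed

text \<open>Replace an edge \<open>xy\<close> by the directed path from \<open>x\<close> through the preoriented vertex to \<open>y\<close>.\<close>

lemma isolated_pull:
  assumes K: "2 \<le> K" and isolated: "isolated K W u E b s w"
    and sl: "\<And>X. X \<subseteq> W \<Longrightarrow> 2 \<le> card X \<Longrightarrow> X \<noteq> W \<Longrightarrow> 2 * K + nrm K (sum b X) \<le> deg E w X"
    and xy: "x \<in> W" "y \<in> W" "x \<noteq> y" "0 < mult E x y"
    and z0: "sum w W < 2 * K - 2 + nrm K (sum s W)"
    and IH: "\<And>b' s' w' E'. size E' < size E \<Longrightarrow> admissible K W u E' b' s' w' \<Longrightarrow> solvable K (insert u W) E' (\<lambda>x. b' x - s' x)"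
  shows "solvable K (insert u W) E (\<lambda>x. b x - s x)"
proof -
  note d = isolatedD[OF isolated]
  obtain R where R: "\<And>X. cut E X = crosses X (x, y) + cut R X" "size E = Suc (size R)" "set_mset R \<subseteq> set_mset E"
      "\<And>f. achievable R f \<Longrightarrow> achievable E (\<lambda>z. f z + dir (x, y) z)"
    by (rule take_edge[OF xy(4)]) blast
  have K0: "K > 0" using K by simp
  define s' where "s' = (\<lambda>z. s z + dir (x, y) z)"
  define w' where "w' = (\<lambda>z. w z + 1 * of_bool (z = x) + 1 * of_bool (z = y))"
  have fin: "finite X" if "X \<subseteq> W" for X using that d(1) finite_subset by auto
  have sum_w': "sum w' X = sum w X + of_bool (x \<in> X) + of_bool (y \<in> X)" if "X \<subseteq> W" for X
    unfolding w'_def sum.distrib sum_indicator[OF fin[OF that]] by simp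
  have sum_s': "sum s' W = sum s W"
    unfolding s'_def sum.distrib sum_dir[OF d(1)] using xy by simp
  have deg': "deg R w' X = deg E w X + 2 * of_bool (x \<in> X \<and> y \<in> X)" if "X \<subseteq> W" for X
    unfolding deg_def R(1) sum_w'[OF that] by (auto simp: crosses_def)
  have "isolated K W u R b s' w'"
  proof (rule isolated_step[OF K isolated sl])
    show "edges_on W R" using d(4) R(3) by (auto simp: edges_on_def)
    show "w' u = 0" "s' u = 0" "b u = b u" using xy d(2,5,6) by (auto simp: w'_def s'_def dir_def)
    show "(\<Sum>x\<in>W. b x - s' x) = (\<Sum>x\<in>W. b x - s x)"
      unfolding sum_subtractf sum_s' ..
    \<comment> \<open>The preoriented vertex gains two edges; by parity a strict inequality leaves
      room for both.\<close>
    have "even (sum w W + sum s W)" unfolding sum.distrib[symmetric] using d(9) by (intro dvd_sum) auto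
    then have "even (sum w W + nrm K (sum s W))" using nrm_parity[OF K0, of "sum s W"] by presburger
    then have "sum w W + 1 \<noteq> 2 * K - 2 + nrm K (sum s W)" by presburger
    then show "sum w' W \<le> 2 * K - 2 + nrm K (sum s' W)"
      unfolding sum_s' sum_w'[OF subset_refl] using z0 xy by simp
    fix z assume z: "z \<in> W"
    show "\<bar>s' z\<bar> \<le> w' z" using d(8)[OF z] by (auto simp: s'_def w'_def dir_def)
    have "even (1 * of_bool (z = x) + 1 * of_bool (z = y) + dir (x, y) z)" by (auto simp: dir_def)
    then show "even (w' z + s' z)" using d(9)[OF z] unfolding w'_def s'_def by presburger
    have "even (crosses {z} (x, y) + (1 * of_bool (z = x) + 1 * of_bool (z = y)))" by (auto simp: crosses_def)
    then show "even (cut R {z} + w' z + b z)" using d(10)[OF z] R(1)[of "{z}"] unfolding w'_def by presburger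
    show "deg E w {z} - nrm K (b z) \<le> deg R w' {z} - nrm K (b z)"
      using deg'[of "{z}"] z by simp
  next
    fix X assume X: "X \<subseteq> W"
    then show "deg E w X - nrm K (sum b X) - 2 \<le> deg R w' X - nrm K (sum b X)"
      using deg'[OF X] by simp
  qed
  then have "admissible K W u R b s' w'" by (rule isolated_imp_admissible)
  then have "solvable K (insert u W) R (\<lambda>x. b x - s' x)" by (intro IH) (simp add: R(2))
  then obtain f where f: "achievable R f" "\<forall>z\<in>insert u W. 2 * K dvd f z - (b z - s' z)"
    unfolding solvable_def by blast
  have "\<forall>z\<in>insert u W. 2 * K dvd (f z + dir (x, y) z) - (b z - s z)"
    using f(2) by (auto simp: s'_def algebra_simps)
  then show ?thesis using R(4)[OF f(1)] unfolding solvable_def by blast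
qed

text \<open>Remove a preoriented edge at \<open>x\<close>, leaving \<open>x\<close> if \<open>\<epsilon> = -1\<close> and entering \<open>x\<close> if \<open>\<epsilon> = 1\<close>.\<close>

lemma isolated_remove:
  assumes K: "2 \<le> K" and isolated: "isolated K W u E b s w"
    and sl: "\<And>X. X \<subseteq> W \<Longrightarrow> 2 \<le> card X \<Longrightarrow> X \<noteq> W \<Longrightarrow> 2 * K + nrm K (sum b X) \<le> deg E w X"
    and x: "x \<in> W" and eps: "\<epsilon> = 1 \<or> \<epsilon> = -1" and nz: "\<epsilon> * s x < w x"
    and nx: "nrm K (b x + \<epsilon>) = nrm K (b x) - 1"
    and IH: "\<And>b' s' w'. sum w' (insert u W) < sum w (insert u W) \<Longrightarrow> admissible K W u E b' s' w' \<Longrightarrow> solvable K (insert u W) E (\<lambda>x. b' x - s' x)"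
  shows "solvable K (insert u W) E (\<lambda>x. b x - s x)"
proof -
  note d = isolatedD[OF isolated]
  have K0: "K > 0" using K by simp
  define s' where "s' = (\<lambda>z. s z + \<epsilon> * of_bool (z = x))"
  define b' where "b' = (\<lambda>z. b z + \<epsilon> * of_bool (z = x))"
  define w' where "w' = (\<lambda>z. w z + (-1) * of_bool (z = x))"
  have fin: "finite X" if "X \<subseteq> W" for X using that d(1) finite_subset by auto
  have sums: "sum w' X = sum w X - of_bool (x \<in> X)" "sum s' X = sum s X + \<epsilon> * of_bool (x \<in> X)"
    "sum b' X = sum b X + \<epsilon> * of_bool (x \<in> X)" if "X \<subseteq> W" for X
    unfolding w'_def s'_def b'_def sum.distrib sum_indicator[OF fin[OF that]] by simp_all
  have deg': "deg E w' X = deg E w X - of_bool (x \<in> X)" if "X \<subseteq> W" for X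
    unfolding deg_def sums[OF that] by simp
  have u: "w' u = 0" "s' u = 0" "b' u = b u" using x d(2,5,6) by (auto simp: w'_def s'_def b'_def)
  have "isolated K W u E b' s' w'"
  proof (rule isolated_step[OF K isolated sl])
    show "w' u = 0" "s' u = 0" "b' u = b u" by fact+
    show "edges_on W E" by (rule d(4))
    show "(\<Sum>x\<in>W. b' x - s' x) = (\<Sum>x\<in>W. b x - s x)"
      unfolding b'_def s'_def by simp
    have "nrm K (sum s W) \<le> nrm K (sum s' W) + 1"
      using eps x unfolding sums[OF subset_refl] by (intro nrm_shift[OF K0]) auto
    then show "sum w' W \<le> 2 * K - 2 + nrm K (sum s' W)"
      using d(12) x unfolding sums(1)[OF subset_refl] by simp
    fix z assume z: "z \<in> W"
    \<comment> \<open>By parity \<open>\<epsilon> * s x\<close> is at most \<open>w x - 2\<close>,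
      so some preoriented edge at \<open>x\<close> has the direction to be removed.\<close>
    have "\<epsilon> * s x \<noteq> w x - 1"
    proof
      assume *: "\<epsilon> * s x = w x - 1"
      have "even (w x + \<epsilon> * s x)" using d(9)[OF x] eps by auto
      then show False unfolding * by presburger
    qed
    then show "\<bar>s' z\<bar> \<le> w' z" using d(8)[OF z] nz eps by (auto simp: s'_def w'_def)
    have odd: "odd \<epsilon>" using eps by auto
    show "even (w' z + s' z)" using d(9)[OF z] odd by (auto simp: w'_def s'_def)
    show "even (cut E {z} + w' z + b' z)" using d(10)[OF z] odd by (auto simp: w'_def b'_def)
    show "deg E w {z} - nrm K (b z) \<le> deg E w' {z} - nrm K (b' z)"
      using deg'[of "{z}"] z nx by (cases "z = x") (auto simp: b'_def)
  next
    fix X assume X: "X \<subseteq> W"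
    have "nrm K (sum b' X) \<le> nrm K (sum b X) + 1"
      using eps unfolding sums[OF X] by (intro nrm_shift[OF K0]) auto
    then show "deg E w X - nrm K (sum b X) - 2 \<le> deg E w' X - nrm K (sum b' X)"
      using deg'[OF X] by simp
  qed
  then have "admissible K W u E b' s' w'" by (rule isolated_imp_admissible)
  moreover have "sum w' (insert u W) < sum w (insert u W)"
    using d(1,2,5) u x by (simp add: sums(1))
  ultimately have "solvable K (insert u W) E (\<lambda>x. b' x - s' x)" by (intro IH)
  then show ?thesis unfolding b'_def s'_def by simp
qed

text \<open>If all demands are strictly positive, raise the demand at \<open>x\<close> to \<open>K\<close> by adding preoriented
  edges leaving \<open>x\<close>. Since \<open>K \<equiv> - K\<close>, an edge from \<open>y\<close> to \<open>x\<close> can then be oriented and deleted.\<close>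

lemma isolated_raise:
  assumes K: "2 \<le> K" and isolated: "isolated K W u E b s w"
    and sl: "\<And>X. X \<subseteq> W \<Longrightarrow> 2 \<le> card X \<Longrightarrow> X \<noteq> W \<Longrightarrow> 2 * K + nrm K (sum b X) \<le> deg E w X"
    and xy: "x \<in> W" "y \<in> W" "x \<noteq> y" "0 < mult E y x"
    and t: "b x = 2 * K * q + t" "1 \<le> t" "t \<le> K - 1" "nrm K (b x) = t"
    and y: "nrm K (b y - 1) = nrm K (b y) - 1"
    and z0: "sum w W = 2 * K - 1" "2 * K dvd sum s W - 1"
    and IH: "\<And>b' s' w' E'. size E' < size E \<Longrightarrow> admissible K W u E' b' s' w' \<Longrightarrow> solvable K (insert u W) E' (\<lambda>x. b' x - s' x)"
  shows "solvable K (insert u W) E (\<lambda>x. b x - s x)"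
proof -
  note d = isolatedD[OF isolated]
  obtain R where R: "\<And>X. cut E X = crosses X (y, x) + cut R X" "size E = Suc (size R)" "set_mset R \<subseteq> set_mset E"
      "\<And>f. achievable R f \<Longrightarrow> achievable E (\<lambda>z. f z + dir (y, x) z)"
    by (rule take_edge[OF xy(4)]) blast
  have K0: "K > 0" using K by simp
  define j where "j = K - t"
  define s' where "s' = (\<lambda>z. s z + j * of_bool (z = x))"
  define w' where "w' = (\<lambda>z. w z + j * of_bool (z = x))"
  define b' where "b' = (\<lambda>z. b z + j * of_bool (z = x) - dir (y, x) z)"
  have j: "1 \<le> j" using t by (simp add: j_def)
  have fin: "finite X" if "X \<subseteq> W" for X using that d(1) finite_subset by auto
  have sums: "sum w' X = sum w X + j * of_bool (x \<in> X)" "sum s' X = sum s X + j * of_bool (x \<in> X)"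
    "sum b' X = sum b X + j * of_bool (x \<in> X) - (\<Sum>z\<in>X. dir (y, x) z)" if "X \<subseteq> W" for X
    unfolding w'_def s'_def b'_def sum.distrib sum_subtractf sum_indicator[OF fin[OF that]] by simp_all
  have deg': "deg R w' X = deg E w X + j * of_bool (x \<in> X) - crosses X (y, x)" if "X \<subseteq> W" for X
    unfolding deg_def R(1) sums[OF that] by simp
  have u: "w' u = 0" "s' u = 0" "b' u = b u" using xy d(2,5,6) by (auto simp: w'_def s'_def b'_def dir_def)
  have bx: "nrm K (b' x) = K - 1"
  proof -
    \<comment> \<open>The \<open>j\<close> new edges bring the demand at \<open>x\<close> to
      \<open>K\<close>; the edge from \<open>y\<close> then moves it to \<open>K + 1\<close>, which
      is \<open>1 - K\<close> modulo \<open>2 * K\<close> and has smaller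
      \<open>nrm\<close>.\<close>
    have "b' x = 2 * K * (q + 1) + (1 - K)" using t xy by (simp add: b'_def j_def algebra_simps)
    then show ?thesis using nrm_eq[OF K0, of "1 - K" "q + 1"] K by simp
  qed
  have "isolated K W u R b' s' w'"
  proof (rule isolated_step[OF K isolated sl])
    show "w' u = 0" "s' u = 0" "b' u = b u" by fact+
    show "edges_on W R" using d(4) R(3) by (auto simp: edges_on_def)
    show "(\<Sum>x\<in>W. b' x - s' x) = (\<Sum>x\<in>W. b x - s x)"
      unfolding sum_subtractf sums[OF subset_refl] sum_dir[OF d(1)] using xy by simp
    \<comment> \<open>The total \<open>sum s W\<close> is 1 modulo \<open>2 * K\<close>, and every
      new edge moves it one step further from 0. The bound on the preoriented vertex thus grows as
      fast as its degree. From \<open>t \<ge> 1\<close> it follows that \<open>1 + j\<close> stays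
      within \<open>K\<close>.\<close>
    have "nrm K (sum s' W) = nrm K (1 + j)"
      unfolding sums[OF subset_refl] by (rule nrm_cong) (use z0(2) xy in \<open>simp add: algebra_simps\<close>)
    also have "\<dots> = 1 + j" using nrm_eq[OF K0, of "1 + j" 0] j t by (simp add: j_def)
    finally show "sum w' W \<le> 2 * K - 2 + nrm K (sum s' W)"
      unfolding sums(1)[OF subset_refl] using z0(1) xy by simp
    fix z assume z: "z \<in> W"
    show "\<bar>s' z\<bar> \<le> w' z" using d(8)[OF z] j by (auto simp: s'_def w'_def)
    show "even (w' z + s' z)" using d(9)[OF z] by (auto simp: w'_def s'_def)
    have "even (crosses {z} (y, x) + dir (y, x) z)" by (auto simp: crosses_def dir_def)
    moreover have "cut R {z} + w' z + b' z =
        (cut E {z} + w z + b z) - (crosses {z} (y, x) + dir (y, x) z) + 2 * (j * of_bool (z = x))"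
      using R(1)[of "{z}"] unfolding w'_def b'_def by simp
    ultimately show "even (cut R {z} + w' z + b' z)" using d(10)[OF z] by simp
    show "deg E w {z} - nrm K (b z) \<le> deg R w' {z} - nrm K (b' z)"
    proof -
      consider "z = x" | "z = y" | "z \<noteq> x" "z \<noteq> y" by blast
      then show ?thesis
      proof cases
        case 1
        then show ?thesis using deg'[of "{x}"] bx t(4) xy by (simp add: crosses_def j_def)
      next
        case 2
        then have "b' z = b y - 1" using xy by (simp add: b'_def)
        then show ?thesis using 2 deg'[of "{y}"] y xy by (simp add: crosses_def)
      next
        case 3
        then show ?thesis using deg'[of "{z}"] z by (simp add: crosses_def b'_def dir_def)
      qed
    qed
  next
    fix X assume X: "X \<subseteq> W"
    define i where "i = j * of_bool (x \<in> X)"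
    \<comment> \<open>The added preoriented edges raise degree and demand of \<open>X\<close> by the
      same \<open>i\<close>, so only the deleted edge can cause a loss, of at most 2.\<close>
    have "sum b' X = sum b X + (i - (\<Sum>z\<in>X. dir (y, x) z))" unfolding sums[OF X] i_def by simp
    then have "nrm K (sum b' X) \<le> nrm K (sum b X) + \<bar>i - (\<Sum>z\<in>X. dir (y, x) z)\<bar>"
      using nrm_triangle[OF K0, of "sum b X" "i - (\<Sum>z\<in>X. dir (y, x) z)"]
        nrm_le_self[OF K0, of "i - (\<Sum>z\<in>X. dir (y, x) z)"] by simp
    moreover have "0 \<le> i" using j by (simp add: i_def)
    moreover have "crosses X (y, x) = \<bar>\<Sum>z\<in>X. dir (y, x) z\<bar>" by (rule crosses_eq_sum_dir[OF fin[OF X]])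
    moreover have "crosses X (y, x) \<le> 1" by (simp add: crosses_def)
    moreover have "deg R w' X = deg E w X + i - crosses X (y, x)" using deg'[OF X] unfolding i_def .
    ultimately show "deg E w X - nrm K (sum b X) - 2 \<le> deg R w' X - nrm K (sum b' X)"
      by linarith
  qed
  then have "admissible K W u R b' s' w'" by (rule isolated_imp_admissible)
  then have "solvable K (insert u W) R (\<lambda>x. b' x - s' x)" by (intro IH) (simp add: R(2))
  then obtain f where f: "achievable R f" "\<forall>z\<in>insert u W. 2 * K dvd f z - (b' z - s' z)"
    unfolding solvable_def by blast
  have "\<forall>z\<in>insert u W. 2 * K dvd (f z + dir (y, x) z) - (b z - s z)"
    using f(2) by (auto simp: b'_def s'_def algebra_simps)
  then show ?thesis using R(4)[OF f(1)] unfolding solvable_def by blast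
qed

text \<open>With all demands positive no edge can be oriented directly, unless some demand is
  \<open>K\<close>. The preoriented vertex is used instead: it absorbs an edge if its degree is
  below the bound, and a preoriented edge leaving a vertex of \<open>W\<close> can be discarded
  together with one unit of demand. What remains is the case that all its edges are directed into
  \<open>W\<close> and the bound is attained.\<close>

lemma isolated_positive:
  assumes K: "2 \<le> K" and isolated: "isolated K W u E b s w"
    and sl: "\<And>X. X \<subseteq> W \<Longrightarrow> 2 \<le> card X \<Longrightarrow> X \<noteq> W \<Longrightarrow> 2 * K + nrm K (sum b X) \<le> deg E w X"
    and pos: "\<And>x. x \<in> W \<Longrightarrow> nrm K (b x - 1) = nrm K (b x) - 1"
    and IH1: "\<And>b' s' w' E'. size E' < size E \<Longrightarrow> admissible K W u E' b' s' w' \<Longrightarrow> solvable K (insert u W) E' (\<lambda>x. b' x - s' x)"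
    and IH2: "\<And>b' s' w'. sum w' (insert u W) < sum w (insert u W) \<Longrightarrow> admissible K W u E b' s' w' \<Longrightarrow> solvable K (insert u W) E (\<lambda>x. b' x - s' x)"
  shows "solvable K (insert u W) E (\<lambda>x. b x - s x)"
proof -
  note d = isolatedD[OF isolated]
  have K0: "K > 0" using K by simp
  obtain x where x: "x \<in> W" using d(3) by fastforce
  have "W \<noteq> {x}" using d(3) by auto
  then obtain y where y: "y \<in> W" "y \<noteq> x" "0 < mult E x y"
    using isolated_edge[OF K isolated, of "{x}"] x by auto
  have sym: "mult E y x = mult E x y" unfolding mult_def by (simp add: disj_commute)
  show ?thesis
  proof (cases "sum w W < 2 * K - 2 + nrm K (sum s W)")
    case True
    show ?thesis by (rule isolated_pull[OF K isolated sl x y(1) _ y(3) True IH1]) (use y in auto)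
  next
    case False
    then have z0: "sum w W = 2 * K - 2 + nrm K (sum s W)" using d(12) by simp
    show ?thesis
    proof (cases "nrm K (b x + 1) = nrm K (b x) - 1")
      case True
      show ?thesis
        by (rule isolated_orient[OF K isolated sl y(1) x y(2) _ pos[OF y(1)] True IH1]) (use y sym in auto)
    next
      case notK: False
      show ?thesis
      proof (cases "\<exists>z\<in>W. - s z < w z")
        case True
        then obtain z where z: "z \<in> W" "- 1 * s z < w z" by auto
        show ?thesis by (rule isolated_remove[OF K isolated sl z(1) _ z(2) _ IH2]) (use pos[OF z(1)] in auto)
      next
        case False
        then have "s z = - w z" if "z \<in> W" for z using d(8)[OF that] that by force
        then have sw: "sum s W = - sum w W" by (simp add: sum_negf)
        define D where "D = sum w W"
        \<comment> \<open>This equation has one solution: \<open>D \<ge> 2 * K\<close> would give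
          \<open>D = D - 2\<close>, and below \<open>2 * K\<close> it reads
          \<open>D = 4 * K - 2 - D\<close>.\<close>
        have D: "D = 2 * K - 2 + nrm K D" using z0 nrm_uminus[OF K0, of D] unfolding sw D_def by simp
        have "0 \<le> nrm K D" "nrm K D \<le> K" using nrm_nonneg[OF K0] nrm_le[OF K0] by auto
        then have "\<bar>D - 2 * K\<bar> \<le> K" using D K by linarith
        then have "nrm K D = \<bar>D - 2 * K\<bar>" using nrm_eq[OF K0, of "D - 2 * K" 1] by simp
        then have D1: "D = 2 * K - 1" using D by linarith
        obtain q t where t: "b x = 2 * K * q + t" "1 \<le> t" "t \<le> K - 1" "nrm K (b x) = t"
          using nrm_strict_pos[OF K0 pos[OF x] notK] by metis
        have "sum s W - 1 = 2 * K * (-1)" using sw D1 unfolding D_def by simp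
        then have "2 * K dvd sum s W - 1" by (metis dvd_triv_left)
        then show ?thesis
          using D1 y sym
          by (intro isolated_raise[OF K isolated sl x y(1) _ _ t pos[OF y(1)] _ _ IH1]) (auto simp: D_def)
      qed
    qed
  qed
qed

text \<open>The measure is lexicographic. Contracting and exempting a vertex shrink
  \<open>W\<close>. Lifting, orienting, pulling and raising remove an edge from \<open>E\<close>,
  though they may add preoriented edges, so these are counted last. Discarding a preoriented edge
  lowers only the last component.\<close>

theorem admissible_solvable:
  fixes W :: "'v set"
  assumes K: "2 \<le> K"
  shows "admissible K W u E b s w \<Longrightarrow> solvable K (insert u W) E (\<lambda>x. b x - s x)"
proof (induction "(W, u, E, b, s, w)" arbitrary: W u E b s w
    rule: wf_induct_rule[OF wf_measures[of "[\<lambda>(W, u, E, b, s, w). card W, \<lambda>(W, u, E, b, s, w). size E,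
      \<lambda>(W, u, E, b, s, w). nat (sum w (insert u W))]"]])
  case (1 W u E b s w)
  note admissible = 1(2)
  have IH0: "solvable K (insert u' W') E' (\<lambda>x. b' x - s' x)"
    if "card W' < card W" "admissible K W' u' E' b' s' w'" for W' :: "'v set" and u' E' b' s' w'
    by (rule 1(1)[OF _ that(2)]) (use that in simp)
  have IH1: "solvable K (insert u W) E' (\<lambda>x. b' x - s' x)"
    if "size E' < size E" "admissible K W u E' b' s' w'" for E' b' s' w'
    by (rule 1(1)[OF _ that(2)]) (use that in simp)
  have IH2: "solvable K (insert u W) E (\<lambda>x. b' x - s' x)"
    if "sum w' (insert u W) < sum w (insert u W)" "admissible K W u E b' s' w'" for b' s' w'
  proof (rule 1(1)[OF _ that(2)])
    have "0 \<le> sum w' (insert u W)"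
      by (rule sum_nonneg) (use admissibleD(5)[OF that(2)] in force)
    then show "((W, u, E, b', s', w'), W, u, E, b, s, w) \<in> measures [\<lambda>(W, u, E, b, s, w). card W,
        \<lambda>(W, u, E, b, s, w). size E, \<lambda>(W, u, E, b, s, w). nat (sum w (insert u W))]"
      using that(1) by simp
  qed
  note g = admissibleD[OF admissible]
  have K0: "K > 0" using K by simp
  show ?case
  proof (cases "\<exists>X. X \<subseteq> insert u W \<and> 2 \<le> card (X \<inter> W) \<and> \<not> W \<subseteq> X \<and> deg E w X \<le> 2 * K - 2 + nrm K (sum b X)")
    case True
    then obtain X where X: "X \<subseteq> insert u W" "2 \<le> card (X \<inter> W)" "\<not> W \<subseteq> X"
      "deg E w X \<le> 2 * K - 2 + nrm K (sum b X)" by blast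
    show ?thesis by (rule tight_contract[OF K admissible X IH0])
  next
    case False
    then have sl0: "2 * K + nrm K (sum b X) \<le> deg E w X"
      if "X \<subseteq> insert u W" "2 \<le> card (X \<inter> W)" "\<not> W \<subseteq> X" for X
      using slack[OF K admissible that(1)] that by blast
    show ?thesis
    proof (cases "0 < cut E {u} + w u")
      case True
      show ?thesis by (rule special_lift[OF K admissible True sl0 IH1])
    next
      case False
      moreover have "0 \<le> w u" using g(5)[of u] by simp
      ultimately have isolated: "isolated K W u E b s w"
        using cut_nonneg[of E "{u}"] by (intro admissible_imp_isolated[OF admissible]) simp
      note d = isolatedD[OF isolated]
      have sl: "2 * K + nrm K (sum b X) \<le> deg E w X" if "X \<subseteq> W" "2 \<le> card X" "X \<noteq> W" for X
        using that by (intro sl0) (auto simp: Int_absorb2)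
      show ?thesis
      proof (cases "card W = 2")
        case True
        then show ?thesis by (rule two_vertices[OF K isolated])
      next
        case False
        then have W: "3 \<le> card W" using d(3) by simp
        show ?thesis
        proof (cases "\<exists>x\<in>W. \<exists>y\<in>W. x \<noteq> y \<and> K - 1 \<le> mult E x y")
          case True
          then obtain x y where xy: "x \<in> W" "y \<in> W" "x \<noteq> y" "K - 1 \<le> mult E x y" by blast
          show ?thesis by (rule parallel_contract[OF K isolated W xy IH0])
        next
          case False
          then have m: "mult E x y \<le> K - 1" if "x \<in> W" "y \<in> W" "x \<noteq> y" for x y
            using that by force
          show ?thesis
          proof (cases "\<exists>x\<in>W. 2 * K dvd b x")
            case True
            then obtain x where x: "x \<in> W" "2 * K dvd b x" by blast
            have "card (W - {x}) < card W" using x d(1) by (intro psubset_card_mono) auto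
            from IH0[OF this zero_special[OF K isolated W sl m x]]
            have "solvable K W E (\<lambda>x. b x - s x)" using x by (simp add: insert_absorb)
            then show ?thesis by (rule isolated_solvable[OF isolated])
          next
            case False
            \<comment> \<open>Demand \<open>K\<close> is counted as positive here. With 0 excluded,
              every vertex outside \<open>P\<close> has negative demand.\<close>
            define P where "P = {x\<in>W. nrm K (b x - 1) = nrm K (b x) - 1}"
            have neg: "nrm K (b x + 1) = nrm K (b x) - 1" if "x \<in> W - P" for x
              using that False nrm_trichotomy[OF K0, of "b x"] by (auto simp: P_def)
            have PW: "P \<subseteq> W" by (auto simp: P_def)
            consider "P = W" | "P = {}" | "P \<noteq> {}" "P \<noteq> W" by blast
            then show ?thesis
            proof cases
              case 1
              then have pos: "nrm K (b x - 1) = nrm K (b x) - 1" if "x \<in> W" for x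
                using that by (auto simp: P_def)
              show ?thesis by (rule isolated_positive[OF K isolated sl pos IH1 IH2])
            next
              case 2
              \<comment> \<open>All demands are negative; reversing every edge makes them
                positive.\<close>
              have good': "admissible K W u E (\<lambda>x. - b x) (\<lambda>x. - s x) w" by (rule admissible_uminus[OF K0 admissible])
              have iso': "isolated K W u E (\<lambda>x. - b x) (\<lambda>x. - s x) w"
                using False \<open>\<not> 0 < cut E {u} + w u\<close> \<open>0 \<le> w u\<close> cut_nonneg[of E "{u}"]
                by (intro admissible_imp_isolated[OF good']) simp
              have "solvable K (insert u W) E (\<lambda>x. - b x - - s x)"
              proof (rule isolated_positive[OF K iso' _ _ IH1 IH2])
                show "2 * K + nrm K (\<Sum>x\<in>X. - b x) \<le> deg E w X" if "X \<subseteq> W" "2 \<le> card X" "X \<noteq> W" for X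
                  using sl[OF that] by (simp add: sum_negf nrm_uminus[OF K0])
                show "nrm K (- b x - 1) = nrm K (- b x) - 1" if "x \<in> W" for x
                proof -
                  have "- b x - 1 = - (b x + 1)" by simp
                  then show ?thesis using neg[of x] that 2 by (simp only: nrm_uminus[OF K0]) simp
                qed
              qed
              then show ?thesis by (rule solvable_uminus)
            next
              case 3
              obtain x y where xy: "x \<in> P" "y \<in> W - P" "0 < mult E x y"
                using isolated_edge[OF K isolated PW 3] by blast
              show ?thesis
                by (rule isolated_orient[OF K isolated sl _ _ _ xy(3) _ neg[OF xy(2)] IH1])
                  (use xy in \<open>auto simp: P_def\<close>)
            qed
          qed
        qed
      qed
    qed
  qed
qed

section \<open>Modulo orientations with prescribed boundary\<close>

definition vdir :: "('e \<Rightarrow> 'v \<times> 'v) \<Rightarrow> 'e set \<Rightarrow> 'e \<Rightarrow> 'v \<Rightarrow> int" where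
  "vdir ep S e x = (if e \<in> S then dir (ep e) x else - dir (ep e) x)"

text \<open>There are no preoriented edges at the start. The set condition could ask for
  \<open>2 * K - 2 + K = 3 * K - 2\<close>; parity saves one edge.\<close>

theorem boundary_orientation:
  fixes K :: int
  assumes K: "odd K" "3 \<le> K" and G: "multigraph V P ep"
    and conn: "\<And>X. X \<subseteq> V \<Longrightarrow> X \<noteq> {} \<Longrightarrow> X \<noteq> V \<Longrightarrow> 3 * K - 3 \<le> int (card (edge_cut P ep X))"
    and \<beta>: "K dvd sum \<beta> V"
  shows "\<exists>S. \<forall>x\<in>V. K dvd (\<Sum>e\<in>P. vdir ep S e x) - \<beta> x"
proof (cases "2 \<le> card V")
  case False
  have finV: "finite V" and P: "\<And>e. e \<in> P \<Longrightarrow> fst (ep e) \<in> V \<and> snd (ep e) \<in> V \<and> fst (ep e) \<noteq> snd (ep e)"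
    using G by (auto simp: multigraph_def)
  have "P = {}"
  proof (rule ccontr)
    assume "P \<noteq> {}"
    then obtain e where "e \<in> P" by blast
    then have "card {fst (ep e), snd (ep e)} \<le> card V" using P finV by (intro card_mono) auto
    then show False using P[OF \<open>e \<in> P\<close>] False by simp
  qed
  moreover have "K dvd - \<beta> x" if "x \<in> V" for x
  proof -
    have "card V = 1" using that False finV card_gt_0_iff[of V] by fastforce
    then have "V = {x}" using that by (auto simp: card_1_singleton_iff)
    then show ?thesis using \<beta> by simp
  qed
  ultimately show ?thesis by auto
next
  case True
  have finV: "finite V" and finP: "finite P"
    and P: "\<And>e. e \<in> P \<Longrightarrow> fst (ep e) \<in> V \<and> snd (ep e) \<in> V \<and> fst (ep e) \<noteq> snd (ep e)"
    using G by (auto simp: multigraph_def)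
  \<comment> \<open>The option type supplies \<open>None\<close> as a fresh vertex for the exempt
    role, which must lie outside \<open>W\<close>.\<close>
  define \<phi> where "\<phi> = (\<lambda>e. map_prod Some Some (ep e))"
  define M where "M = image_mset \<phi> (mset_set P)"
  let ?W = "Some ` V"
  have cutM: "cut M X = int (card (edge_cut P ep {v\<in>V. Some v \<in> X}))" for X
  proof -
    have "cut M X = (\<Sum>e\<in>P. crosses X (\<phi> e))" unfolding cut_def M_def
      by (simp add: sum_unfold_sum_mset image_mset.compositionality comp_def)
    also have "\<dots> = (\<Sum>e\<in>P. of_bool ((fst (ep e) \<in> {v\<in>V. Some v \<in> X}) \<noteq> (snd (ep e) \<in> {v\<in>V. Some v \<in> X})))"
      by (intro sum.cong) (use P in \<open>auto simp: crosses_def \<phi>_def\<close>)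
    also have "\<dots> = int (card (edge_cut P ep {v\<in>V. Some v \<in> X}))"
      unfolding edge_cut_def using finP by (simp add: of_bool_def sum.If_cases Int_def)
    finally show ?thesis .
  qed
  \<comment> \<open>Adding the odd number \<open>K\<close> corrects the parity of the demand to that
    of the degree and keeps its residue modulo \<open>K\<close>.\<close>
  define b where "b = (\<lambda>z. case z of None \<Rightarrow> 0 | Some x \<Rightarrow> \<beta> x + (if even (\<beta> x + cut M {Some x}) then 0 else K))"
  have par: "even (cut M {Some x} + b (Some x))" for x using K(1) by (auto simp: b_def)
  have Kb: "K dvd b (Some x) - \<beta> x" for x by (simp add: b_def)
  have par': "even (cut M X + sum b X)" if X: "X \<subseteq> ?W" for X
  proof -
    have "finite X" using X finV finite_subset by auto
    then have "even (deg M (\<lambda>_. 0) X + sum b X)" by (rule deg_parity) (use X par in auto)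
    then show ?thesis by (simp add: deg_def)
  qed
  have onM: "edges_on ?W M" using P finP by (auto simp: edges_on_def M_def \<phi>_def)
  have "isolated K ?W None M b (\<lambda>_. 0) (\<lambda>_. 0)"
    unfolding isolated_def
  proof (intro conjI ballI allI impI)
    show "finite ?W" "None \<notin> ?W" "(0::int) = 0" "(0::int) = 0" using finV by auto
    show "2 \<le> card ?W" using True by (simp add: card_image)
    show "edges_on ?W M" by fact
    show "2 * K dvd b None" by (simp add: b_def)
    have "cut M ?W = 0" using cut_compl[OF onM, of "{}"] by (simp add: cut_def crosses_def)
    then have "2 dvd sum b ?W" using par'[of ?W] by simp
    moreover have "K dvd sum b ?W"
    proof -
      have "sum b ?W = (\<Sum>x\<in>V. b (Some x) - \<beta> x) + sum \<beta> V"
        by (simp add: sum.reindex sum_subtractf)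
      then show ?thesis using \<beta> Kb by (simp add: dvd_sum)
    qed
    moreover have "coprime 2 K" using K(1) by simp
    ultimately show "2 * K dvd (\<Sum>x\<in>?W. b x - 0)" by (simp add: divides_mult)
    show "(\<Sum>x\<in>?W. 0) \<le> 2 * K - 2 + nrm K (\<Sum>x\<in>?W. 0)" using K nrm_nonneg[of K 0] by simp
  next
    fix x assume "x \<in> ?W"
    then show "\<bar>0::int\<bar> \<le> 0" "even (0 + 0 :: int)" "even (cut M {x} + 0 + b x)" using par by auto
  next
    fix X assume X: "X \<subseteq> ?W \<and> X \<noteq> {} \<and> X \<noteq> ?W"
    have "{v\<in>V. Some v \<in> X} \<noteq> {}" "{v\<in>V. Some v \<in> X} \<noteq> V" using X by auto
    then have 1: "3 * K - 3 \<le> cut M X" unfolding cutM by (intro conn) auto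
    have 2: "nrm K (sum b X) \<le> K" using K by (intro nrm_le) simp
    have "even (nrm K (sum b X) + sum b X)" using K by (intro nrm_parity) simp
    then have "even (nrm K (sum b X) + cut M X)" using par'[of X] X by presburger
    \<comment> \<open>The extreme value \<open>K\<close> is odd and forces an odd cut, whereas
      \<open>3 * K - 3\<close> is even.\<close>
    then have "nrm K (sum b X) = K \<Longrightarrow> cut M X \<noteq> 3 * K - 3" using K(1) by auto
    then show "2 * K - 2 + nrm K (sum b X) \<le> deg M (\<lambda>_. 0) X"
      using 1 2 by (cases "nrm K (sum b X) = K") (auto simp: deg_def)
  qed
  then have "solvable K (insert None ?W) M (\<lambda>x. b x - 0)"
    using K by (intro admissible_solvable isolated_imp_admissible) auto
  then obtain f where f: "achievable M f" "\<forall>x\<in>insert None ?W. 2 * K dvd f x - b x" by (auto simp: solvable_def)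
  obtain Q R where QR: "M = Q + R" "f = (\<lambda>x. net Q x - net R x)" using f(1) by (auto simp: achievable_def)
  obtain A B where AB: "mset_set P = A + B" "Q = image_mset \<phi> A" "R = image_mset \<phi> B"
    using image_mset_eq_plusD[OF QR(1)[unfolded M_def]] by blast
  define S where "S = set_mset A"
  have cnt: "count A e + count B e = (if e \<in> P then 1 else 0)" for e
    using AB(1) finP by (metis count_mset_set(1,3) count_union)
  have SP: "S \<subseteq> P" using cnt by (auto simp: S_def count_inI dest!: count_inI split: if_splits) (metis add_is_0 count_eq_zero_iff cnt)
  have A: "A = mset_set S"
  proof (rule multiset_eqI)
    fix e show "count A e = count (mset_set S) e"
    proof (cases "e \<in> S")
      case True
      then have "0 < count A e" by (simp add: S_def)
      moreover have "count A e \<le> 1" using cnt[of e] by (simp split: if_splits)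
      moreover have "count (mset_set S) e = 1" using True by (simp add: S_def)
      ultimately show ?thesis by linarith
    next
      case False
      then show ?thesis by (simp add: S_def not_in_iff)
    qed
  qed
  have B: "B = mset_set (P - S)"
  proof (rule multiset_eqI)
    fix e show "count B e = count (mset_set (P - S)) e"
      using cnt[of e, unfolded A] finP SP finite_subset[OF SP finP]
      by (cases "e \<in> S"; cases "e \<in> P") auto
  qed
  have net: "net (image_mset \<phi> (mset_set T)) (Some x) = (\<Sum>e\<in>T. dir (ep e) x)" for T x
    unfolding net_def by (simp add: sum_unfold_sum_mset image_mset.compositionality comp_def \<phi>_def dir_def)
  have fx: "f (Some x) = (\<Sum>e\<in>P. vdir ep S e x)" for x
  proof -
    have "(\<Sum>e\<in>P. vdir ep S e x) = (\<Sum>e\<in>P - S. vdir ep S e x) + (\<Sum>e\<in>S. vdir ep S e x)"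
      using sum.subset_diff[OF SP finP] .
    also have "(\<Sum>e\<in>P - S. vdir ep S e x) = - (\<Sum>e\<in>P - S. dir (ep e) x)"
      unfolding sum_negf[symmetric] by (intro sum.cong) (auto simp: vdir_def)
    also have "(\<Sum>e\<in>S. vdir ep S e x) = (\<Sum>e\<in>S. dir (ep e) x)"
      by (intro sum.cong) (auto simp: vdir_def)
    finally show ?thesis unfolding QR(2) AB(2,3) A B net by simp
  qed
  have "K dvd (\<Sum>e\<in>P. vdir ep S e x) - \<beta> x" if "x \<in> V" for x
  proof -
    have "2 * K dvd f (Some x) - b (Some x)" using f(2) that by auto
    then have "K dvd f (Some x) - b (Some x)" by (rule dvd_mult_right)
    from dvd_add[OF this Kb[of x]] show ?thesis unfolding fx by simp
  qed
  then show ?thesis by blast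
qed

section \<open>Switching\<close>

lemma signature_equivalent:
  assumes "equivalent V ep \<sigma> \<sigma>'" "signature E \<sigma>" shows "signature E \<sigma>'"
  using assms unfolding equivalent_def
proof (induction rule: rtranclp_induct)
  case (step s t)
  then have "\<forall>e\<in>E. s e = 1 \<or> s e = -1" by (simp add: signature_def)
  moreover obtain v where "t = switch ep v s" using step by blast
  ultimately show ?case by (force simp: signature_def switch_def)
qed

text \<open>The vertices of \<open>X\<close> are switched one at a time. An edge with both ends in
  \<open>X\<close> is negated twice; a loop would be negated only once, whence the restriction to
  distinct ends.\<close>

lemma switch_set:
  fixes ep :: "'e \<Rightarrow> 'v \<times> 'v"
  assumes "finite X" "X \<subseteq> V"
  obtains \<sigma>' where "equivalent V ep \<sigma> \<sigma>'"
    "\<And>e. fst (ep e) \<noteq> snd (ep e) \<Longrightarrow>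
      \<sigma>' e = (if (fst (ep e) \<in> X) \<noteq> (snd (ep e) \<in> X) then - \<sigma> e else \<sigma> e)"
proof -
  define switched where "switched = (\<lambda>Y \<rho>. equivalent V ep \<sigma> \<rho> \<and> (\<forall>e. fst (ep e) \<noteq> snd (ep e) \<longrightarrow>
    \<rho> e = (if (fst (ep e) \<in> Y) \<noteq> (snd (ep e) \<in> Y) then - \<sigma> e else \<sigma> e)))"
  have 0: "switched {} \<sigma>" by (simp add: switched_def equivalent_def)
  have step: "switched (insert v Y) (switch ep v \<rho>)" if "v \<in> V" "v \<notin> Y" "switched Y \<rho>" for v Y \<rho>
  proof -
    have "equivalent V ep \<sigma> \<rho>" using that(3) by (simp add: switched_def)
    then have "equivalent V ep \<sigma> (switch ep v \<rho>)" unfolding equivalent_def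
      by (rule rtranclp.rtrancl_into_rtrancl) (rule bexI[OF _ that(1)], rule refl)
    moreover have "switch ep v \<rho> e =
        (if (fst (ep e) \<in> insert v Y) \<noteq> (snd (ep e) \<in> insert v Y) then - \<sigma> e else \<sigma> e)"
      if e: "fst (ep e) \<noteq> snd (ep e)" for e
    proof -
      have "\<rho> e = (if (fst (ep e) \<in> Y) \<noteq> (snd (ep e) \<in> Y) then - \<sigma> e else \<sigma> e)"
        using \<open>switched Y \<rho>\<close> e by (simp add: switched_def)
      then show ?thesis
        using e \<open>v \<notin> Y\<close> by (cases "v = fst (ep e)"; cases "v = snd (ep e)")
          (simp_all add: switch_def incident_def)
    qed
    ultimately show ?thesis unfolding switched_def by simp
  qed
  have "\<exists>\<rho>. switched X \<rho>"
    using assms by (rule finite_subset_induct) (use 0 step in blast)+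
  then show thesis using that unfolding switched_def by blast
qed

text \<open>Flipping every half-edge at \<open>v\<close> turns an orientation for the switched signs
  into one for the original signs. It exchanges the two degrees at \<open>v\<close> and keeps those
  elsewhere.\<close>

lemma mod_orientation_switch:
  assumes G: "multigraph V E ep" and sg: "signature E \<sigma>" and \<tau>: "mod_orientation m V E ep (switch ep v \<sigma>) \<tau>"
  shows "mod_orientation m V E ep \<sigma> (\<lambda>e x. if x = v then \<not> \<tau> e x else \<tau> e x)" (is "mod_orientation m V E ep \<sigma> ?\<tau>")
  unfolding mod_orientation_def
proof (intro conjI ballI)
  show "orientation E ep \<sigma> ?\<tau>"
    unfolding orientation_def
  proof
    fix e assume e: "e \<in> E"
    have "fst (ep e) \<noteq> snd (ep e)" using G e by (auto simp: multigraph_def)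
    moreover have "(switch ep v \<sigma> e = 1 \<longrightarrow> \<tau> e (fst (ep e)) \<noteq> \<tau> e (snd (ep e))) \<and>
        (switch ep v \<sigma> e = -1 \<longrightarrow> \<tau> e (fst (ep e)) = \<tau> e (snd (ep e)))"
      using \<tau> e by (auto simp: mod_orientation_def orientation_def)
    ultimately show "(\<sigma> e = 1 \<longrightarrow> ?\<tau> e (fst (ep e)) \<noteq> ?\<tau> e (snd (ep e))) \<and>
        (\<sigma> e = -1 \<longrightarrow> ?\<tau> e (fst (ep e)) = ?\<tau> e (snd (ep e)))"
      by (auto simp: switch_def incident_def)
  qed
  fix x assume "x \<in> V"
  then have "(int (out_deg E ep \<tau> x) - int (in_deg E ep \<tau> x)) mod int m = 0"
    using \<tau> by (auto simp: mod_orientation_def)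
  moreover have "out_deg E ep ?\<tau> v = in_deg E ep \<tau> v" "in_deg E ep ?\<tau> v = out_deg E ep \<tau> v"
    by (simp_all add: out_deg_def in_deg_def)
  moreover have "out_deg E ep ?\<tau> x = out_deg E ep \<tau> x" "in_deg E ep ?\<tau> x = in_deg E ep \<tau> x" if "x \<noteq> v"
    using that by (simp_all add: out_deg_def in_deg_def)
  ultimately show "(int (out_deg E ep ?\<tau> x) - int (in_deg E ep ?\<tau> x)) mod int m = 0"
    by (cases "x = v") (auto simp: mod_eq_0_iff_dvd dvd_diff_commute)
qed

lemma mod_orientation_equivalent:
  assumes "equivalent V ep \<sigma> \<sigma>'" and G: "multigraph V E ep" and "signature E \<sigma>"
    and "\<exists>\<tau>. mod_orientation m V E ep \<sigma>' \<tau>"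
  shows "\<exists>\<tau>. mod_orientation m V E ep \<sigma> \<tau>"
  using assms(1,4) unfolding equivalent_def
proof (induction rule: rtranclp_induct)
  case base
  then show ?case .
next
  case (step s t)
  have "signature E s" using signature_equivalent step(1) assms(3) unfolding equivalent_def by blast
  then show ?case using step mod_orientation_switch[OF G] by blast
qed

theorem theorem4:
  fixes k :: nat and V :: "'v set" and E :: "'e set" and ep :: "'e \<Rightarrow> 'v \<times> 'v"
    and \<sigma> :: "'e \<Rightarrow> int"
  assumes "k \<ge> 1"
    and "multigraph V E ep"
    and "signature E \<sigma>"
    and "edge_connected (12 * k - 1) V E ep"
    and "essentially_unbalanced (2 * k + 1) V E ep \<sigma>"
  shows "\<exists>\<tau>. mod_orientation (2 * k + 1) V E ep \<sigma> \<tau>"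
proof -
  have finV: "finite V" and finE: "finite E"
    and ends: "\<And>e. e \<in> E \<Longrightarrow> fst (ep e) \<in> V \<and> snd (ep e) \<in> V \<and> fst (ep e) \<noteq> snd (ep e)"
    using assms(2) by (auto simp: multigraph_def)
  have "equivalent V ep \<sigma> \<sigma>" by (simp add: equivalent_def)
  then obtain \<sigma>' where \<sigma>': "equivalent V ep \<sigma> \<sigma>'"
    and least: "\<And>\<rho>. equivalent V ep \<sigma> \<rho> \<Longrightarrow> card (neg_edges E \<sigma>') \<le> card (neg_edges E \<rho>)"
    using ex_has_least_nat[of "equivalent V ep \<sigma>" \<sigma> "\<lambda>\<rho>. card (neg_edges E \<rho>)"] by blast
  have sg: "signature E \<sigma>'" using signature_equivalent[OF \<sigma>' assms(3)] .
  define N where "N = neg_edges E \<sigma>'"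
  define P where "P = E - N"
  have NE: "N \<subseteq> E" by (auto simp: N_def neg_edges_def)
  have fin: "finite N" "finite P" using NE finE finite_subset by (auto simp: P_def)
  have signs: "\<sigma>' e = -1" if "e \<in> N" for e using that by (auto simp: N_def neg_edges_def)
  have signs': "\<sigma>' e = 1" if "e \<in> P" for e using that sg by (auto simp: P_def N_def neg_edges_def signature_def)
  \<comment> \<open>Switching all of \<open>X\<close> exchanges the signs on its cut
    \<open>C\<close>, so by minimality \<open>C\<close> has no more negative than positive
    edges.\<close>
  have cutP: "6 * k \<le> card (edge_cut P ep X)" if X: "X \<subseteq> V" "X \<noteq> {}" "X \<noteq> V" for X
  proof -
    define C where "C = edge_cut E ep X"
    have CE: "C \<subseteq> E" and finC: "finite C" using finE by (auto simp: C_def edge_cut_def)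
    obtain \<rho> where \<rho>: "equivalent V ep \<sigma>' \<rho>"
      "\<And>e. fst (ep e) \<noteq> snd (ep e) \<Longrightarrow> \<rho> e = (if (fst (ep e) \<in> X) \<noteq> (snd (ep e) \<in> X) then - \<sigma>' e else \<sigma>' e)"
      using switch_set[OF finite_subset[OF X(1) finV] X(1)] by metis
    have "neg_edges E \<rho> = (N - C) \<union> (C - N)"
    proof -
      have "e \<in> neg_edges E \<rho> \<longleftrightarrow> e \<in> (N - C) \<union> (C - N)" if "e \<in> E" for e
      proof (cases "e \<in> N")
        case True
        then show ?thesis using that \<rho>(2)[of e] ends[OF that] signs[of e]
          by (auto simp: neg_edges_def C_def edge_cut_def)
      next
        case False
        then have "\<sigma>' e = 1" using that signs'[of e] by (simp add: P_def)
        then show ?thesis using that False \<rho>(2)[of e] ends[OF that]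
          by (auto simp: neg_edges_def C_def edge_cut_def)
      qed
      then show ?thesis using CE NE by (auto simp: neg_edges_def)
    qed
    moreover have "equivalent V ep \<sigma> \<rho>" using \<sigma>' \<rho>(1) unfolding equivalent_def by (rule rtranclp_trans)
    ultimately have "card N \<le> card ((N - C) \<union> (C - N))" using least[of \<rho>] by (simp add: N_def)
    also have "\<dots> \<le> card (N - C) + card (C - N)" by (rule card_Un_le)
    finally have "card (N \<inter> C) \<le> card (C - N)" using card_Int_Diff[OF fin(1), of C] by simp
    moreover have "card C = card (N \<inter> C) + card (C - N)" using card_Int_Diff[OF finC, of N] by (simp add: Int_commute)
    moreover have "12 * k - 1 \<le> card C" using assms(4) X by (auto simp: edge_connected_def C_def)
    \<comment> \<open>Half of \<open>12 * k - 1\<close>, rounded up, is \<open>6 * k\<close>, and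
      this equals \<open>3 * K - 3\<close> for \<open>K = 2 * k + 1\<close>.\<close>
    ultimately have "6 * k \<le> card (C - N)" by arith
    moreover have "C - N = edge_cut P ep X" by (auto simp: C_def edge_cut_def P_def)
    ultimately show ?thesis by simp
  qed
  let ?K = "int (2 * k + 1)"
  have "even (card N) \<or> 2 * k + 1 \<le> card N"
    using assms(5) \<sigma>' by (auto simp: essentially_unbalanced_def N_def)
  \<comment> \<open>The number of sink edges is \<open>j\<close>, so sinks minus sources is
    \<open>2 * j - card N\<close>. It is made 0 if \<open>card N\<close> is even and
    \<open>2 * k + 1\<close> if it is odd; in the latter case \<open>card N \<ge> 2 * k + 1\<close>
    guarantees that \<open>j\<close> is at most \<open>card N\<close>.\<close>
  then obtain j where j: "j \<le> card N" "?K dvd 2 * int j - int (card N)"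
  proof (cases "even (card N)")
    case True
    then obtain i where "card N = 2 * i" by blast
    then show thesis by (intro that[of i]) auto
  next
    case False
    assume *: "even (card N) \<or> 2 * k + 1 \<le> card N"
    have "even (card N + (2 * k + 1))" using False by simp
    then obtain i where "card N + (2 * k + 1) = 2 * i" by blast
    then have eq: "2 * int i - int (card N) = ?K" and "i \<le> card N" using * False by linarith+
    show thesis by (rule that[OF \<open>i \<le> card N\<close>]) (simp only: eq dvd_refl)
  qed
  obtain T where T: "T \<subseteq> N" "card T = j" using obtain_subset_with_card_n[OF j(1)] by metis
  define sgn_T :: "'e \<Rightarrow> int" where "sgn_T = (\<lambda>e. if e \<in> T then 1 else -1)"
  \<comment> \<open>The positive edges have to cancel what the negative edges contribute at each
    vertex. A negative edge contributes the same sign at both ends, so these demands add up to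
    \<open>-2 * (2 * j - card N)\<close>.\<close>
  define \<beta> where "\<beta> = (\<lambda>x. - (\<Sum>e\<in>N. of_bool (incident ep x e) * sgn_T e))"
  have sum_T: "(\<Sum>e\<in>N. sgn_T e) = 2 * int j - int (card N)"
  proof -
    have "(\<Sum>e\<in>N. sgn_T e) = (\<Sum>e\<in>N. 2 * of_bool (e \<in> T) - 1)"
      by (intro sum.cong) (auto simp: sgn_T_def)
    also have "\<dots> = 2 * int (card (N \<inter> T)) - int (card N)"
      using fin(1) by (simp add: sum_subtractf sum_distrib_left[symmetric] of_bool_def sum.If_cases Int_def)
    also have "N \<inter> T = T" using T by auto
    finally show ?thesis using T by simp
  qed
  have "?K dvd sum \<beta> V"
  proof -
    have "(\<Sum>x\<in>V. of_bool (incident ep x e)) = (2::int)" if "e \<in> N" for e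
    proof -
      have "e \<in> E" using that NE by auto
      note e = ends[OF this]
      have "(\<Sum>x\<in>V. of_bool (incident ep x e)) = (\<Sum>x\<in>V. of_bool (x = fst (ep e)) + of_bool (x = snd (ep e)) :: int)"
        by (intro sum.cong) (use e in \<open>auto simp: incident_def\<close>)
      also have "\<dots> = 2" using e finV by (simp add: sum.distrib of_bool_def sum.delta)
      finally show ?thesis .
    qed
    then have "(\<Sum>e\<in>N. (\<Sum>x\<in>V. of_bool (incident ep x e)) * sgn_T e) = (\<Sum>e\<in>N. 2 * sgn_T e)"
      by (intro sum.cong) auto
    then have "(\<Sum>x\<in>V. \<Sum>e\<in>N. of_bool (incident ep x e) * sgn_T e) = 2 * (\<Sum>e\<in>N. sgn_T e)"
      by (subst sum.swap) (simp add: sum_distrib_right sum_distrib_left)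
    then have "sum \<beta> V = (-2) * (2 * int j - int (card N))"
      unfolding \<beta>_def sum_negf sum_T by simp
    then show ?thesis using j(2) by (metis dvd_mult)
  qed
  moreover have "multigraph V P ep" using finV fin ends by (auto simp: multigraph_def P_def)
  moreover have "3 * ?K - 3 \<le> int (card (edge_cut P ep X))" if "X \<subseteq> V" "X \<noteq> {}" "X \<noteq> V" for X
    using cutP[OF that] by simp
  ultimately obtain S where S: "\<And>x. x \<in> V \<Longrightarrow> ?K dvd (\<Sum>e\<in>P. vdir ep S e x) - \<beta> x"
    using boundary_orientation[of ?K V P ep \<beta>] assms(1) by auto
  \<comment> \<open>A positive edge in \<open>S\<close> leaves its first end; one outside
    \<open>S\<close> leaves its second end.\<close>
  define \<tau> where "\<tau> = (\<lambda>e x. if e \<in> N then e \<in> T else (e \<in> S) = (x = fst (ep e)))"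
  have "mod_orientation (2 * k + 1) V E ep \<sigma>' \<tau>"
    unfolding mod_orientation_def
  proof (intro conjI ballI)
    show "orientation E ep \<sigma>' \<tau>" unfolding orientation_def
    proof
      fix e assume e: "e \<in> E"
      show "(\<sigma>' e = 1 \<longrightarrow> \<tau> e (fst (ep e)) \<noteq> \<tau> e (snd (ep e))) \<and> (\<sigma>' e = -1 \<longrightarrow> \<tau> e (fst (ep e)) = \<tau> e (snd (ep e)))"
        using ends[OF e] signs[of e] signs'[of e] e by (cases "e \<in> N") (auto simp: \<tau>_def P_def)
    qed
    fix x assume x: "x \<in> V"
    define c where "c = (\<lambda>e. of_bool (incident ep x e) * (if \<tau> e x then 1 else -1 :: int))"
    have "int (out_deg E ep \<tau> x) - int (in_deg E ep \<tau> x) = (\<Sum>e\<in>E. c e)"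
    proof -
      have "int (out_deg E ep \<tau> x) = (\<Sum>e\<in>E. of_bool (incident ep x e \<and> \<tau> e x))"
        "int (in_deg E ep \<tau> x) = (\<Sum>e\<in>E. of_bool (incident ep x e \<and> \<not> \<tau> e x))"
        unfolding out_deg_def in_deg_def using finE by (simp_all add: of_bool_def sum.If_cases Int_def)
      then have "int (out_deg E ep \<tau> x) - int (in_deg E ep \<tau> x) =
          (\<Sum>e\<in>E. of_bool (incident ep x e \<and> \<tau> e x) - of_bool (incident ep x e \<and> \<not> \<tau> e x))"
        by (simp only: sum_subtractf)
      also have "\<dots> = (\<Sum>e\<in>E. c e)" by (intro sum.cong) (auto simp: c_def)
      finally show ?thesis .
    qed
    also have "\<dots> = (\<Sum>e\<in>P. c e) + (\<Sum>e\<in>N. c e)"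
      unfolding P_def using sum.subset_diff[OF NE finE] .
    also have "(\<Sum>e\<in>P. c e) = (\<Sum>e\<in>P. vdir ep S e x)"
    proof (rule sum.cong[OF refl])
      fix e assume "e \<in> P"
      then show "c e = vdir ep S e x"
        using ends[of e] by (auto simp: P_def c_def \<tau>_def vdir_def dir_def incident_def)
    qed
    also have "(\<Sum>e\<in>N. c e) = - \<beta> x"
      unfolding \<beta>_def minus_minus by (rule sum.cong) (auto simp: c_def \<tau>_def sgn_T_def)
    finally show "(int (out_deg E ep \<tau> x) - int (in_deg E ep \<tau> x)) mod int (2 * k + 1) = 0"
      using S[OF x] by (simp add: mod_eq_0_iff_dvd)
  qed
  then show ?thesis using mod_orientation_equivalent[OF \<sigma>' assms(2,3)] by blast
qed

end
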